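(* Let $k\ge3$, $\Gamma=\Gamma(k)$, and let $\beta_1,\beta_2$ denote the locally defined Betti coordinates on $\mathcal M^0_\Gamma$. The 2-form $d\beta_1\wedge d\beta_2$ is independent of the choice of abelian logarithm and is globally defined on $\mathcal M^0_\Gamma$. Furthermore, $\mu=d\beta_1\wedge d\beta_2$ on $\mathcal M^0_\Gamma$.
   Context: $\mathcal H$ is the upper half plane, $\Gamma(k)\subset\mathrm{SL}(2,\mathbb Z)$ is the principal congruence subgroup of level $k$, and $\mathcal M^0_\Gamma=(\mathcal H\times\mathbb C)/(\Gamma\ltimes\mathbb Z^2)$ for the action $(\tau,z)\mapsto\left(\frac{a\tau+b}{c\tau+d},\frac{z+\alpha+\beta\tau}{c\tau+d}\right)$. The form $\mu=i\partial\bar\partial\frac{(\mathrm{Im}\,z)^2}{\mathrm{Im}\,\tau}$ on $\mathcal H\times\mathbb C$ is invariant under $\mathrm{SL}(2,\mathbb R)\ltimes\mathbb R^2$ (same formula for the action) and descends to a form on $\mathcal M^0_\Gamma$, still denoted $\mu$. For a sufficiently small connected open $U\subset\mathcal M^0_\Gamma$, an abelian logarithm is a choice of open set $\mathfrak U\subset\mathcal H\times\mathbb C$ mapped biholomorphically onto $U$ by the quotient map; the Betti coordinates on $U$ for this choice are the real-valued functions $\beta_1,\beta_2$ determined by $z=\beta_1+\beta_2\tau$, where $(\tau,z)\in\mathfrak U$ corresponds to the point of $U$. *)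

theory Defs
  imports "HOL-Analysis.Analysis" "HOL-Number_Theory.Cong"
begin

section \<open>Differential forms on open subsets of the complex plane squared\<close>

definition cscale :: "complex \<Rightarrow> complex \<times> complex \<Rightarrow> complex \<times> complex"
  where "cscale a v = (a * fst v, a * snd v)"

text \<open>Holomorphy on an open set of two complex variables: the real derivative exists everywhere
  and is complex linear.\<close>

definition holomorphic2_on ::
    "(complex \<times> complex \<Rightarrow> complex \<times> complex) \<Rightarrow> (complex \<times> complex) set \<Rightarrow> bool"
  where "holomorphic2_on f S \<longleftrightarrow>
    (\<forall>x\<in>S. \<exists>L. (f has_derivative L) (at x) \<and> (\<forall>a v. L (cscale a v) = cscale a (L v)))"

text \<open>All forms are complex valued and take real tangent vectors as arguments. The functions below are
  the (1,0)-part and the (0,1)-part of the differential of a function.\<close>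

definition del_fun ::
    "(complex \<times> complex \<Rightarrow> complex) \<Rightarrow> complex \<times> complex \<Rightarrow> complex \<times> complex \<Rightarrow> complex"
  where "del_fun f x v =
    (frechet_derivative f (at x) v - \<i> * frechet_derivative f (at x) (cscale \<i> v)) / 2"

definition delbar_fun ::
    "(complex \<times> complex \<Rightarrow> complex) \<Rightarrow> complex \<times> complex \<Rightarrow> complex \<times> complex \<Rightarrow> complex"
  where "delbar_fun f x v =
    (frechet_derivative f (at x) v + \<i> * frechet_derivative f (at x) (cscale \<i> v)) / 2"

text \<open>The operator \<open>\<partial>\<close> on 1-forms acts on coefficients:
  \<open>\<partial>(\<Sum>\<^sub>J a\<^sub>J dx\<^sub>J) = \<Sum>\<^sub>J \<partial>a\<^sub>J \<and> dx\<^sub>J\<close>. Evaluated on two constant vector fields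
  this is the formula below, with the convention
  \<open>(a \<and> b)(v, w) = a(v) b(w) - a(w) b(v)\<close>, which is used throughout.\<close>

definition del_form1 ::
    "(complex \<times> complex \<Rightarrow> complex \<times> complex \<Rightarrow> complex) \<Rightarrow>
      complex \<times> complex \<Rightarrow> complex \<times> complex \<Rightarrow> complex \<times> complex \<Rightarrow> complex"
  where "del_form1 \<alpha> x v w = del_fun (\<lambda>y. \<alpha> y w) x v - del_fun (\<lambda>y. \<alpha> y v) x w"

definition mu :: "complex \<times> complex \<Rightarrow> complex \<times> complex \<Rightarrow> complex \<times> complex \<Rightarrow> complex"
  where "mu x v w =
    \<i> * del_form1 (delbar_fun (\<lambda>(\<tau>, z). complex_of_real ((Im z)\<^sup>2 / Im \<tau>))) x v w"

section \<open>Tangent vectors and forms on a manifold given by an atlas\<close>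

text \<open>A chart is a pair of its domain and its coordinate map; values of the map outside the domain are
  irrelevant.\<close>

type_synonym ('m, 'e) chart = "'m set \<times> ('m \<Rightarrow> 'e)"

definition chart_inv :: "('m, 'e) chart \<Rightarrow> 'e \<Rightarrow> 'm"
  where "chart_inv c = inv_into (fst c) (snd c)"

definition charts_at :: "('m, 'e) chart set \<Rightarrow> 'm \<Rightarrow> ('m, 'e) chart set"
  where "charts_at A p = {c \<in> A. p \<in> fst c}"

text \<open>A tangent vector at \<open>p\<close> is the family of its coordinate vectors in all the charts at \<open>p\<close>, related
  by the derivatives of the transition maps (and set to zero for the other charts). The vector
  space operations are pointwise.\<close>

definition tangent_space ::
    "('m, 'e::real_normed_vector) chart set \<Rightarrow> 'm \<Rightarrow> (('m, 'e) chart \<Rightarrow> 'e) set"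
  where "tangent_space A p = {\<xi>.
    (\<forall>c. c \<notin> charts_at A p \<longrightarrow> \<xi> c = 0) \<and>
    (\<forall>c\<in>charts_at A p. \<forall>c'\<in>charts_at A p.
      \<xi> c' = frechet_derivative (snd c' \<circ> chart_inv c) (at (snd c p)) (\<xi> c))}"

text \<open>Differential at \<open>x\<close> of a map from a normed space to the manifold.\<close>

definition push_vec ::
    "('m, 'e::real_normed_vector) chart set \<Rightarrow> ('f::real_normed_vector \<Rightarrow> 'm) \<Rightarrow> 'f \<Rightarrow> 'f \<Rightarrow>
      ('m, 'e) chart \<Rightarrow> 'e"
  where "push_vec A f x v =
    (\<lambda>c. if c \<in> charts_at A (f x) then frechet_derivative (snd c \<circ> f) (at x) v else 0)"

text \<open>Differential of a function defined near \<open>p\<close>: the common value of its coordinate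
  expressions in all charts at \<open>p\<close>.\<close>

definition mdiff ::
    "('m, 'e::real_normed_vector) chart set \<Rightarrow> ('m \<Rightarrow> complex) \<Rightarrow> 'm \<Rightarrow>
      (('m, 'e) chart \<Rightarrow> 'e) \<Rightarrow> complex"
  where "mdiff A f p \<xi> =
    (THE y. \<forall>c\<in>charts_at A p. y = frechet_derivative (f \<circ> chart_inv c) (at (snd c p)) (\<xi> c))"

definition wedge :: "('m \<Rightarrow> 'v \<Rightarrow> complex) \<Rightarrow> ('m \<Rightarrow> 'v \<Rightarrow> complex) \<Rightarrow> 'm \<Rightarrow> 'v \<Rightarrow> 'v \<Rightarrow> complex"
  where "wedge \<alpha> \<beta> p \<xi> \<eta> = \<alpha> p \<xi> * \<beta> p \<eta> - \<alpha> p \<eta> * \<beta> p \<xi>"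

text \<open>\<open>C\<^sup>n\<close> on an open subset of a finite-dimensional space, through iterated directional
  derivatives.\<close>

primrec Cn_on ::
    "nat \<Rightarrow> ('a::real_normed_vector \<Rightarrow> 'b::real_normed_vector) \<Rightarrow> 'a set \<Rightarrow> bool" where
  "Cn_on 0 f S \<longleftrightarrow> continuous_on S f"
| "Cn_on (Suc n) f S \<longleftrightarrow>
    (\<forall>x\<in>S. f differentiable (at x)) \<and>
    (\<forall>v. Cn_on n (\<lambda>x. frechet_derivative f (at x) v) S)"

definition smooth_on :: "('a::real_normed_vector \<Rightarrow> 'b::real_normed_vector) \<Rightarrow> 'a set \<Rightarrow> bool"
  where "smooth_on f S \<longleftrightarrow> (\<forall>n. Cn_on n f S)"

text \<open>Smooth 2-forms on the manifold \<open>X\<close> with atlas \<open>A\<close>. Smoothness is that of the coefficients in every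
  chart; \<open>push_vec A (chart_inv c) x v\<close> is the constant coordinate field \<open>v\<close> of the chart \<open>c\<close>.\<close>

definition two_form_on ::
    "('m, 'e::real_normed_vector) chart set \<Rightarrow> 'm set \<Rightarrow>
      ('m \<Rightarrow> (('m, 'e) chart \<Rightarrow> 'e) \<Rightarrow> (('m, 'e) chart \<Rightarrow> 'e) \<Rightarrow> complex) \<Rightarrow> bool"
  where "two_form_on A X \<omega> \<longleftrightarrow>
    (\<forall>p\<in>X. \<forall>\<xi>\<in>tangent_space A p. \<forall>\<eta>\<in>tangent_space A p.
      \<omega> p \<eta> \<xi> = - \<omega> p \<xi> \<eta> \<and>
      (\<forall>r. \<omega> p (\<lambda>c. r *\<^sub>R \<xi> c) \<eta> = complex_of_real r * \<omega> p \<xi> \<eta>) \<and>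
      (\<forall>\<zeta>\<in>tangent_space A p. \<omega> p (\<lambda>c. \<xi> c + \<zeta> c) \<eta> = \<omega> p \<xi> \<eta> + \<omega> p \<zeta> \<eta>)) \<and>
    (\<forall>c\<in>A. \<forall>v w.
      smooth_on (\<lambda>x. \<omega> (chart_inv c x) (push_vec A (chart_inv c) x v) (push_vec A (chart_inv c) x w))
        (snd c ` fst c))"

definition form_eq_on ::
    "('m, 'e::real_normed_vector) chart set \<Rightarrow> 'm set \<Rightarrow>
      ('m \<Rightarrow> (('m, 'e) chart \<Rightarrow> 'e) \<Rightarrow> (('m, 'e) chart \<Rightarrow> 'e) \<Rightarrow> complex) \<Rightarrow>
      ('m \<Rightarrow> (('m, 'e) chart \<Rightarrow> 'e) \<Rightarrow> (('m, 'e) chart \<Rightarrow> 'e) \<Rightarrow> complex) \<Rightarrow> bool"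
  where "form_eq_on A U \<omega> \<omega>' \<longleftrightarrow>
    (\<forall>p\<in>U. \<forall>\<xi>\<in>tangent_space A p. \<forall>\<eta>\<in>tangent_space A p. \<omega> p \<xi> \<eta> = \<omega>' p \<xi> \<eta>)"

section \<open>The quotient\<close>

definition Gamma_level :: "nat \<Rightarrow> (int ^ 2 ^ 2) set"
  where "Gamma_level k =
    {A. det A = 1 \<and> (\<forall>i j. [A $ i $ j = (mat 1 :: int ^ 2 ^ 2) $ i $ j] (mod int k))}"

definition HC :: "(complex \<times> complex) set"
  where "HC = {\<tau>. Im \<tau> > 0} \<times> UNIV"

definition act :: "int ^ 2 ^ 2 \<Rightarrow> int \<times> int \<Rightarrow> complex \<times> complex \<Rightarrow> complex \<times> complex"
  where "act A = (\<lambda>(\<alpha>, \<beta>) (\<tau>, z).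
    ((of_int (A $ 1 $ 1) * \<tau> + of_int (A $ 1 $ 2)) / (of_int (A $ 2 $ 1) * \<tau> + of_int (A $ 2 $ 2)),
     (z + of_int \<alpha> + of_int \<beta> * \<tau>) / (of_int (A $ 2 $ 1) * \<tau> + of_int (A $ 2 $ 2))))"

definition orbit_rel :: "nat \<Rightarrow> ((complex \<times> complex) \<times> (complex \<times> complex)) set"
  where "orbit_rel k = {(x, y). x \<in> HC \<and> (\<exists>A\<in>Gamma_level k. \<exists>ab. y = act A ab x)}"

type_synonym point = "(complex \<times> complex) set"

definition M0 :: "nat \<Rightarrow> point set"
  where "M0 k = HC // orbit_rel k"

definition proj :: "nat \<Rightarrow> complex \<times> complex \<Rightarrow> point"
  where "proj k x = orbit_rel k `` {x}"

definition M0_top :: "nat \<Rightarrow> point topology"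
  where "M0_top k = topology (\<lambda>U. U \<subseteq> M0 k \<and> open (HC \<inter> proj k -` U))"

lemma openin_M0_top: "openin (M0_top k) U \<longleftrightarrow> U \<subseteq> M0 k \<and> open (HC \<inter> proj k -` U)"
proof -
  have "istopology (\<lambda>U. U \<subseteq> M0 k \<and> open (HC \<inter> proj k -` U))"
    unfolding istopology_def
  proof (intro conjI allI impI)
    fix S T assume "S \<subseteq> M0 k \<and> open (HC \<inter> proj k -` S)" "T \<subseteq> M0 k \<and> open (HC \<inter> proj k -` T)"
    moreover have "HC \<inter> proj k -` (S \<inter> T) = (HC \<inter> proj k -` S) \<inter> (HC \<inter> proj k -` T)" by auto
    ultimately show "S \<inter> T \<subseteq> M0 k" "open (HC \<inter> proj k -` (S \<inter> T))" by auto
  next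
    fix K assume K: "\<forall>S\<in>K. S \<subseteq> M0 k \<and> open (HC \<inter> proj k -` S)"
    then show "\<Union> K \<subseteq> M0 k" by auto
    have "HC \<inter> proj k -` \<Union> K = (\<Union>S\<in>K. HC \<inter> proj k -` S)" by blast
    moreover have "open (\<Union>S\<in>K. HC \<inter> proj k -` S)" using K by (intro open_UN) blast
    ultimately show "open (HC \<inter> proj k -` \<Union> K)" by (simp only:)
  qed
  then show ?thesis by (simp add: M0_top_def)
qed

text \<open>The complex structure on the quotient, for which the projection is locally
  biholomorphic: the charts are the inverses of the projection on the open sets on which
  it is injective.\<close>

definition M0_atlas :: "nat \<Rightarrow> (point, complex \<times> complex) chart set"
  where "M0_atlas k =
    {(proj k ` V, inv_into V (proj k)) | V. V \<subseteq> HC \<and> open V \<and> inj_on (proj k) V}"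

definition maps_biholomorphically :: "nat \<Rightarrow> (complex \<times> complex) set \<Rightarrow> point set \<Rightarrow> bool"
  where "maps_biholomorphically k V U \<longleftrightarrow>
    bij_betw (proj k) V U \<and>
    (\<forall>c\<in>M0_atlas k.
      holomorphic2_on (snd c \<circ> proj k) (V \<inter> proj k -` fst c) \<and>
      holomorphic2_on (inv_into V (proj k) \<circ> chart_inv c) (snd c ` (U \<inter> fst c)))"

definition abelian_log :: "nat \<Rightarrow> point set \<Rightarrow> (complex \<times> complex) set \<Rightarrow> bool"
  where "abelian_log k U V \<longleftrightarrow>
    openin (M0_top k) U \<and> connectedin (M0_top k) U \<and>
    open V \<and> V \<subseteq> HC \<and> maps_biholomorphically k V U"

definition betti :: "nat \<Rightarrow> (complex \<times> complex) set \<Rightarrow> point \<Rightarrow> real \<times> real"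
  where "betti k V p = (let (\<tau>, z) = inv_into V (proj k) p
    in THE (b1, b2). z = complex_of_real b1 + complex_of_real b2 * \<tau>)"

definition betti_form ::
    "nat \<Rightarrow> (complex \<times> complex) set \<Rightarrow> point \<Rightarrow>
      ((point, complex \<times> complex) chart \<Rightarrow> complex \<times> complex) \<Rightarrow>
      ((point, complex \<times> complex) chart \<Rightarrow> complex \<times> complex) \<Rightarrow> complex"
  where "betti_form k V =
    wedge (mdiff (M0_atlas k) (\<lambda>p. complex_of_real (fst (betti k V p))))
          (mdiff (M0_atlas k) (\<lambda>p. complex_of_real (snd (betti k V p))))"

text \<open>The form on the quotient whose pullback under the projection is \<open>mu\<close>. It is unique on
  tangent vectors, because the differential of the projection is surjective.\<close>

definition descends_to ::
    "nat \<Rightarrow> (complex \<times> complex \<Rightarrow> complex \<times> complex \<Rightarrow> complex \<times> complex \<Rightarrow> complex) \<Rightarrow>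
      (point \<Rightarrow> ((point, complex \<times> complex) chart \<Rightarrow> complex \<times> complex) \<Rightarrow>
        ((point, complex \<times> complex) chart \<Rightarrow> complex \<times> complex) \<Rightarrow> complex) \<Rightarrow> bool"
  where "descends_to k \<theta> \<nu> \<longleftrightarrow>
    two_form_on (M0_atlas k) (M0 k) \<nu> \<and>
    (\<forall>x\<in>HC. \<forall>v w.
      \<nu> (proj k x) (push_vec (M0_atlas k) (proj k) x v) (push_vec (M0_atlas k) (proj k) x w) = \<theta> x v w)"

definition mu_M0 ::
    "nat \<Rightarrow> point \<Rightarrow> ((point, complex \<times> complex) chart \<Rightarrow> complex \<times> complex) \<Rightarrow>
      ((point, complex \<times> complex) chart \<Rightarrow> complex \<times> complex) \<Rightarrow> complex"
  where "mu_M0 k = (SOME \<nu>. descends_to k mu \<nu>)"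

end

theory Submission
  imports Defs
begin

text \<open>
On \<open>HC\<close> the Betti coordinates are globally defined real functions: \<open>z = \<beta>\<^sub>1 + \<beta>\<^sub>2 \<tau>\<close> gives
\<open>\<beta>\<^sub>2 = Im z / Im \<tau>\<close> and \<open>\<beta>\<^sub>1 = Re z - \<beta>\<^sub>2 Re \<tau>\<close>. Rewriting \<open>z + \<alpha> + \<beta> \<tau>\<close> in the basis
\<open>c \<tau> + d\<close>, \<open>a \<tau> + b\<close> of the same lattice shows that a group element changes \<open>(\<beta>\<^sub>1, \<beta>\<^sub>2)\<close> by an affine
map whose linear part has determinant \<open>a d - b c = 1\<close> (\<open>betti_act\<close>). Hence \<open>d\<beta>\<^sub>1 \<and> d\<beta>\<^sub>2\<close> is invariant
(\<open>betti_area_act\<close>). An abelian logarithm is a local section of the projection, two such sections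
differ locally by a group element, and so the form does not depend on the choice.

The equality \<open>\<mu> = d\<beta>\<^sub>1 \<and> d\<beta>\<^sub>2\<close> is a computation on \<open>HC\<close> (\<open>mu_eq_betti_area\<close>). It becomes short when
tangent vectors \<open>v\<close> enter through \<open>V = v\<^sub>z - \<beta>\<^sub>2 v\<^sub>\<tau>\<close>: both forms send \<open>(v, w)\<close> to
\<open>Im (cnj V * W) / Im \<tau>\<close>. In particular \<open>\<mu>\<close> inherits invariance from \<open>d\<beta>\<^sub>1 \<and> d\<beta>\<^sub>2\<close> and descends to the
quotient (\<open>mu_descends\<close>), and the descended form is the global form that the theorem asks for.

All this needs charts and abelian logarithms around every point, that is, a free and properly
discontinuous action (\<open>proj_locally_injective\<close>). Proper discontinuity holds at every level, because
only finitely many group elements can return a small ball to itself. Freeness is where \<open>k \<ge> 3\<close>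
enters: an element of \<open>\<Gamma>(k)\<close> has trace congruent to \<open>2\<close> modulo \<open>k\<^sup>2\<close>, which excludes the traces
\<open>-1, 0, 1\<close> of elliptic elements, and \<open>-1\<close> is not in \<open>\<Gamma>(k)\<close>.
\<close>

section \<open>The action of the group\<close>

definition num :: "int ^ 2 ^ 2 \<Rightarrow> complex \<Rightarrow> complex"
  where "num A \<tau> = of_int (A $ 1 $ 1) * \<tau> + of_int (A $ 1 $ 2)"

definition den :: "int ^ 2 ^ 2 \<Rightarrow> complex \<Rightarrow> complex"
  where "den A \<tau> = of_int (A $ 2 $ 1) * \<tau> + of_int (A $ 2 $ 2)"

definition mat2 :: "int \<Rightarrow> int \<Rightarrow> int \<Rightarrow> int \<Rightarrow> int ^ 2 ^ 2"
  where "mat2 a b c d = vector [vector [a, b], vector [c, d]]"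

lemma mat2_nth [simp]:
  "mat2 a b c d $ 1 $ 1 = a" "mat2 a b c d $ 1 $ 2 = b"
  "mat2 a b c d $ 2 $ 1 = c" "mat2 a b c d $ 2 $ 2 = d"
  by (simp_all add: mat2_def)

lemma mat2_entries: "mat2 (A $ 1 $ 1) (A $ 1 $ 2) (A $ 2 $ 1) (A $ 2 $ 2) = A"
  by (simp add: vec_eq_iff forall_2)

lemma act_eq:
  "act A (m, n) x =
    (num A (fst x) / den A (fst x), (snd x + of_int m + of_int n * fst x) / den A (fst x))"
  by (simp add: act_def num_def den_def split: prod.splits)

lemma HC_iff: "x \<in> HC \<longleftrightarrow> Im (fst x) > 0"
  by (auto simp: HC_def mem_Times_iff)

lemma open_HC: "open HC"
proof -
  have "HC = {x. 0 < Im (fst x)}" using HC_iff by auto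
  moreover have "open {x :: complex \<times> complex. 0 < Im (fst x)}"
    by (intro open_Collect_less continuous_intros)
  ultimately show ?thesis by simp
qed

lemma den_nonzero:
  assumes "det A = 1" "Im \<tau> > 0"
  shows "den A \<tau> \<noteq> 0"
proof
  assume 0: "den A \<tau> = 0"
  then have "Im (den A \<tau>) = 0" by simp
  then have c: "A $ 2 $ 1 = 0" using assms by (simp add: den_def)
  with 0 have "A $ 2 $ 2 = 0" by (simp add: den_def)
  with c assms show False by (simp add: det_2)
qed

lemma of_int_det:
  fixes A :: "int ^ 2 ^ 2"
  assumes "det A = 1"
  shows "of_int (A $ 1 $ 1) * of_int (A $ 2 $ 2) - of_int (A $ 1 $ 2) * of_int (A $ 2 $ 1)
    = (1 :: 'a :: ring_1)"
proof -
  have "of_int (A $ 1 $ 1 * A $ 2 $ 2 - A $ 1 $ 2 * A $ 2 $ 1) = (1 :: 'a)"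
    using assms by (simp only: det_2 of_int_1)
  then show ?thesis by simp
qed

lemma Im_moebius:
  assumes "det A = 1"
  shows "Im (num A \<tau> / den A \<tau>) = Im \<tau> / (cmod (den A \<tau>))\<^sup>2"
proof -
  have "Im (num A \<tau> * cnj (den A \<tau>)) =
      (real_of_int (A $ 1 $ 1) * real_of_int (A $ 2 $ 2) -
      real_of_int (A $ 1 $ 2) * real_of_int (A $ 2 $ 1)) * Im \<tau>"
    by (simp add: num_def den_def algebra_simps)
  also have "\<dots> = Im \<tau>" by (simp only: of_int_det[OF assms] mult_1)
  finally have "Im (num A \<tau> * cnj (den A \<tau>)) = Im \<tau>" .
  then show ?thesis
    by (simp add: complex_div_cnj[of "num A \<tau>"] Im_divide_of_real flip: of_real_power)
qed

lemma act_in_HC: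
  assumes "det A = 1" "x \<in> HC"
  shows "act A mn x \<in> HC"
  using assms den_nonzero[of A "fst x"] by (cases mn) (simp add: HC_iff act_eq Im_moebius)

lemma Gamma_level_det: "A \<in> Gamma_level k \<Longrightarrow> det A = 1"
  by (simp add: Gamma_level_def)

lemma Gamma_level_mult:
  assumes "A \<in> Gamma_level k" "B \<in> Gamma_level k"
  shows "A ** B \<in> Gamma_level k"
proof -
  have "[(A ** B) $ i $ j = (mat 1 :: int ^ 2 ^ 2) $ i $ j] (mod int k)" for i j
  proof -
    have "(A ** B) $ i $ j = (\<Sum>l\<in>UNIV. A $ i $ l * B $ l $ j)"
      by (simp add: matrix_matrix_mult_def)
    moreover have "[(\<Sum>l\<in>UNIV. A $ i $ l * B $ l $ j) =
        (\<Sum>l\<in>UNIV. (mat 1 :: int ^ 2 ^ 2) $ i $ l * (mat 1 :: int ^ 2 ^ 2) $ l $ j)] (mod int k)"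
      using assms by (intro cong_sum cong_mult) (auto simp: Gamma_level_def)
    moreover have "(\<Sum>l\<in>UNIV. (mat 1 :: int ^ 2 ^ 2) $ i $ l * (mat 1 :: int ^ 2 ^ 2) $ l $ j) =
        (mat 1 ** mat 1 :: int ^ 2 ^ 2) $ i $ j"
      by (simp add: matrix_matrix_mult_def)
    ultimately show ?thesis by simp
  qed
  with assms show ?thesis by (simp add: Gamma_level_def det_mul)
qed

lemma one_in_Gamma_level: "mat 1 \<in> Gamma_level k"
  by (simp add: Gamma_level_def)

lemma adjugate_in_Gamma_level:
  assumes "A \<in> Gamma_level k"
  shows "mat2 (A $ 2 $ 2) (- A $ 1 $ 2) (- A $ 2 $ 1) (A $ 1 $ 1) \<in> Gamma_level k"
proof -
  have "[A $ 1 $ 1 = 1] (mod int k)" "[A $ 1 $ 2 = 0] (mod int k)"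
    "[A $ 2 $ 1 = 0] (mod int k)" "[A $ 2 $ 2 = 1] (mod int k)"
    using assms by (simp_all add: Gamma_level_def forall_2 mat_def)
  moreover have "[- (A $ 1 $ 2) = 0] (mod int k)" "[- (A $ 2 $ 1) = 0] (mod int k)"
    using calculation by (simp_all add: cong_0_iff)
  moreover have "A $ 2 $ 2 * A $ 1 $ 1 - A $ 1 $ 2 * A $ 2 $ 1 = 1"
    using Gamma_level_det[OF assms] by (simp add: det_2 mult.commute)
  ultimately show ?thesis
    by (simp add: Gamma_level_def forall_2 mat_def det_2)
qed

lemma act_mat1: "act (mat 1) (0, 0) x = x"
  by (simp add: act_eq num_def den_def mat_def)

text \<open>The translation parts combine through the identity
  \<open>m (c \<tau> + d) + n (a \<tau> + b) = (m d + n b) + (m c + n a) \<tau>\<close>: the inner automorphy factor clears the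
  denominator of \<open>m + n \<tau>'\<close>, and the lattice row vector \<open>(n, m)\<close> is multiplied by the inner matrix.\<close>

lemma act_act:
  assumes "det B = 1" "x \<in> HC"
  shows "act A (m, n) (act B (p, q) x) =
    act (A ** B) (p + m * B $ 2 $ 2 + n * B $ 1 $ 2, q + m * B $ 2 $ 1 + n * B $ 1 $ 1) x"
proof -
  define \<tau> where "\<tau> = fst x"
  have nz: "den B \<tau> \<noteq> 0" using assms den_nonzero by (simp add: HC_iff \<tau>_def)
  have n: "num A (num B \<tau> / den B \<tau>) = num (A ** B) \<tau> / den B \<tau>"
    and d: "den A (num B \<tau> / den B \<tau>) = den (A ** B) \<tau> / den B \<tau>"
    using nz by (simp_all add: num_def den_def matrix_matrix_mult_def sum_2 field_simps)
  have "S / den B \<tau> + of_int m + of_int n * (num B \<tau> / den B \<tau>)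
      = (S + of_int m * den B \<tau> + of_int n * num B \<tau>) / den B \<tau>" for S
    using nz by (simp add: field_simps)
  also have "(snd x + of_int p + of_int q * \<tau>) + of_int m * den B \<tau> + of_int n * num B \<tau>
    = snd x + of_int (p + m * B $ 2 $ 2 + n * B $ 1 $ 2) +
        of_int (q + m * B $ 2 $ 1 + n * B $ 1 $ 1) * \<tau>"
    by (simp add: num_def den_def algebra_simps)
  finally have "(snd x + of_int p + of_int q * \<tau>) / den B \<tau> + of_int m +
      of_int n * (num B \<tau> / den B \<tau>)
    = (snd x + of_int (p + m * B $ 2 $ 2 + n * B $ 1 $ 2) +
        of_int (q + m * B $ 2 $ 1 + n * B $ 1 $ 1) * \<tau>) / den B \<tau>" .
  with n d nz show ?thesis by (simp add: act_eq flip: \<tau>_def)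
qed

lemma act_inverse:
  assumes "A \<in> Gamma_level k"
  obtains B pq where "B \<in> Gamma_level k" "\<And>x. x \<in> HC \<Longrightarrow> act B pq (act A mn x) = x"
proof -
  obtain m n where mn: "mn = (m, n)" by fastforce
  define B where "B = mat2 (A $ 2 $ 2) (- A $ 1 $ 2) (- A $ 2 $ 1) (A $ 1 $ 1)"
  have det: "A $ 1 $ 1 * A $ 2 $ 2 = 1 + A $ 1 $ 2 * A $ 2 $ 1"
    using Gamma_level_det[OF assms] by (simp add: det_2)
  then have BA: "B ** A = mat 1"
    by (simp add: vec_eq_iff forall_2 matrix_matrix_mult_def sum_2 B_def mat_def algebra_simps)
  \<comment> \<open>The translation \<open>(m', n')\<close> solves the linear system that makes the combined translation in
    \<open>act_act\<close> vanish; its matrix has determinant 1.\<close>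
  have "act B (A $ 1 $ 2 * n - A $ 1 $ 1 * m, A $ 2 $ 1 * m - A $ 2 $ 2 * n) (act A mn x) = x"
    if "x \<in> HC" for x
  proof -
    have "m + (A $ 1 $ 2 * n - A $ 1 $ 1 * m) * A $ 2 $ 2 + (A $ 2 $ 1 * m - A $ 2 $ 2 * n) * A $ 1 $ 2
        = m * (1 + A $ 1 $ 2 * A $ 2 $ 1 - A $ 1 $ 1 * A $ 2 $ 2)"
      "n + (A $ 1 $ 2 * n - A $ 1 $ 1 * m) * A $ 2 $ 1 + (A $ 2 $ 1 * m - A $ 2 $ 2 * n) * A $ 1 $ 1
        = n * (1 + A $ 1 $ 2 * A $ 2 $ 1 - A $ 1 $ 1 * A $ 2 $ 2)"
      by (simp_all add: algebra_simps)
    then show ?thesis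
      using that Gamma_level_det[OF assms] by (simp add: mn act_act BA act_mat1 det)
  qed
  moreover have "B \<in> Gamma_level k"
    unfolding B_def by (rule adjugate_in_Gamma_level[OF assms])
  ultimately show ?thesis using that by blast
qed

lemma equiv_orbit_rel: "equiv HC (orbit_rel k)"
proof (rule equivI)
  show "orbit_rel k \<subseteq> HC \<times> HC"
    using act_in_HC Gamma_level_det by (auto simp: orbit_rel_def)
  show "refl_on HC (orbit_rel k)"
  proof (rule refl_onI)
    fix x assume "x \<in> HC"
    moreover have "x = act (mat 1) (0, 0) x" by (simp add: act_mat1)
    ultimately show "(x, x) \<in> orbit_rel k"
      using one_in_Gamma_level unfolding orbit_rel_def by blast
  qed
  show "sym (orbit_rel k)"
  proof (rule symI)
    fix x y assume "(x, y) \<in> orbit_rel k"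
    then obtain A mn where A: "x \<in> HC" "A \<in> Gamma_level k" "y = act A mn x"
      unfolding orbit_rel_def by blast
    then obtain B pq where "B \<in> Gamma_level k" "act B pq y = x"
      using act_inverse by metis
    moreover have "y \<in> HC" using A act_in_HC Gamma_level_det by blast
    ultimately show "(y, x) \<in> orbit_rel k" unfolding orbit_rel_def by blast
  qed
  show "trans (orbit_rel k)"
  proof (rule transI)
    fix x y z assume "(x, y) \<in> orbit_rel k" "(y, z) \<in> orbit_rel k"
    then obtain A m n B p q where *: "x \<in> HC" "A \<in> Gamma_level k" "B \<in> Gamma_level k"
      "y = act B (p, q) x" "z = act A (m, n) y"
      unfolding orbit_rel_def by auto
    then obtain pq where "z = act (A ** B) pq x"
      using act_act[OF Gamma_level_det[OF *(3)] *(1)] by metis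
    with * Gamma_level_mult show "(x, z) \<in> orbit_rel k"
      unfolding orbit_rel_def by blast
  qed
qed

lemma proj_eq_iff:
  assumes "x \<in> HC" "y \<in> HC"
  shows "proj k x = proj k y \<longleftrightarrow> (\<exists>A\<in>Gamma_level k. \<exists>mn. y = act A mn x)"
  using eq_equiv_class_iff[OF equiv_orbit_rel assms] assms by (simp add: proj_def orbit_rel_def)

lemma proj_act:
  assumes "x \<in> HC" "A \<in> Gamma_level k"
  shows "proj k (act A mn x) = proj k x"
  using assms proj_eq_iff[of x "act A mn x" k] act_in_HC Gamma_level_det by metis

lemma proj_in_M0: "x \<in> HC \<Longrightarrow> proj k x \<in> M0 k"
  by (simp add: proj_def M0_def quotientI)

lemma act_has_derivative:
  assumes "det A = 1" "x \<in> HC"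
  shows "\<exists>L. (act A mn has_derivative L) (at x) \<and> (\<forall>a v. L (cscale a v) = cscale a (L v))"
proof -
  obtain m n where mn: "mn = (m, n)" by fastforce
  define J where "J = den A (fst x)"
  define N where "N = num A (fst x)"
  define Z where "Z = snd x + of_int m + of_int n * fst x"
  define a c where "a = complex_of_int (A $ 1 $ 1)" and "c = complex_of_int (A $ 2 $ 1)"
  define L where "L v =
      ((a * fst v * J - N * (c * fst v)) / (J * J),
       ((snd v + of_int n * fst v) * J - Z * (c * fst v)) / (J * J))"
    for v :: "complex \<times> complex"
  have nz: "den A (fst x) \<noteq> 0" using assms den_nonzero by (simp add: HC_iff)
  have N: "((\<lambda>x. num A (fst x)) has_derivative (\<lambda>v. a * fst v)) (at x)"
    unfolding num_def a_def by (auto intro!: derivative_eq_intros)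
  have J: "((\<lambda>x. den A (fst x)) has_derivative (\<lambda>v. c * fst v)) (at x)"
    unfolding den_def c_def by (auto intro!: derivative_eq_intros)
  have Z: "((\<lambda>x. snd x + of_int m + of_int n * fst x) has_derivative
      (\<lambda>v. snd v + of_int n * fst v)) (at x)"
    by (auto intro!: derivative_eq_intros)
  have "((\<lambda>x. (num A (fst x) / den A (fst x), (snd x + of_int m + of_int n * fst x) / den A (fst x)))
      has_derivative L) (at x)"
    unfolding L_def J_def N_def Z_def
    by (rule has_derivative_Pair[OF has_derivative_divide'[OF N J nz] has_derivative_divide'[OF Z J nz]])
  then have "(act A mn has_derivative L) (at x)"
    by (simp add: mn act_eq[abs_def])
  moreover have "L (cscale b v) = cscale b (L v)" for b v
    by (simp add: L_def cscale_def algebra_simps)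
  ultimately show ?thesis by blast
qed

lemma isCont_act: "det A = 1 \<Longrightarrow> x \<in> HC \<Longrightarrow> isCont (act A mn) x"
  using act_has_derivative has_derivative_continuous by blast

section \<open>Freeness and proper discontinuity\<close>

text \<open>A fixed point in the upper half plane is a root of \<open>c \<tau>\<^sup>2 + (d - a) \<tau> - b\<close>. If \<open>c \<noteq> 0\<close>, the
  discriminant \<open>(a + d)\<^sup>2 - 4\<close> is negative; but \<open>k\<^sup>2\<close> divides
  \<open>(a - 1)(d - 1) - b c = 2 - (a + d)\<close>, and \<open>k\<^sup>2 \<ge> 9\<close> is too large for a number among \<open>1, 2, 3\<close>. If
  \<open>c = 0\<close>, the matrix is \<open>1\<close> or \<open>-1\<close>, and \<open>-1\<close> would force \<open>k\<close> to divide \<open>2\<close>.\<close>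

lemma Gamma_level_fixed_point:
  assumes k: "k \<ge> 3" and A: "A \<in> Gamma_level k" and \<tau>: "Im \<tau> > 0"
    and fix_pt: "num A \<tau> = \<tau> * den A \<tau>"
  shows "A = mat 1"
proof -
  define a b c d where abcd: "a = A $ 1 $ 1" "b = A $ 1 $ 2" "c = A $ 2 $ 1" "d = A $ 2 $ 2"
  have det: "a * d - b * c = 1" using Gamma_level_det[OF A] by (simp add: det_2 abcd)
  have "[a = 1] (mod int k)" "[b = 0] (mod int k)" "[c = 0] (mod int k)" "[d = 1] (mod int k)"
    using A by (auto simp: Gamma_level_def forall_2 mat_def abcd)
  then have dv: "int k dvd a - 1" "int k dvd b" "int k dvd c" "int k dvd d - 1"
    by (auto simp: cong_iff_dvd_diff)
  have re: "a * \<tau> + b = \<tau> * (c * \<tau> + d)"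
    using fix_pt by (simp add: num_def den_def abcd)
  have "Im (a * \<tau> + b) = Im (\<tau> * (c * \<tau> + d))" using re by simp
  then have "a * Im \<tau> = (2 * c * Re \<tau> + d) * Im \<tau>" by (simp add: algebra_simps)
  then have im1: "a - d = 2 * c * Re \<tau>" using \<tau> by simp
  have "Re (a * \<tau> + b) = Re (\<tau> * (c * \<tau> + d))" using re by simp
  then have "b = c * ((Re \<tau>)\<^sup>2 - (Im \<tau>)\<^sup>2) - (a - d) * Re \<tau>"
    by (simp add: power2_eq_square algebra_simps)
  then have b: "b = - c * ((Re \<tau>)\<^sup>2 + (Im \<tau>)\<^sup>2)"
    unfolding im1 by (simp add: power2_eq_square algebra_simps)
  have "c = 0"
  proof (rule ccontr)
    assume c: "c \<noteq> 0"
    have "real_of_int ((a + d)\<^sup>2 - 4) = real_of_int ((a - d)\<^sup>2 + 4 * b * c)"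
    proof -
      have "(a + d)\<^sup>2 - 4 * (a * d - b * c) = (a - d)\<^sup>2 + 4 * b * c"
        by (simp add: power2_eq_square algebra_simps)
      then show ?thesis using det by simp
    qed
    also have "\<dots> = - 4 * (c * Im \<tau>)\<^sup>2"
    proof -
      have "real_of_int (a - d) = 2 * c * Re \<tau>" using im1 by simp
      then have "real_of_int ((a - d)\<^sup>2 + 4 * b * c) = (2 * c * Re \<tau>)\<^sup>2 + 4 * real_of_int b * c"
        by simp
      then show ?thesis unfolding b by (simp add: power2_eq_square algebra_simps)
    qed
    also have "\<dots> < 0" using c \<tau> by simp
    finally have "(a + d)\<^sup>2 - 4 < 0" by (simp only: of_int_less_0_iff)
    then have tr: "(a + d)\<^sup>2 < 2\<^sup>2" by simp
    then have tr': "\<bar>a + d\<bar> < 2" using power2_less_imp_less[of "\<bar>a + d\<bar>" 2] by simp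
    have "int k * int k dvd (a - 1) * (d - 1) - b * c"
      by (intro dvd_diff mult_dvd_mono dv)
    also have "(a - 1) * (d - 1) - b * c = 2 - (a + d)" using det by (simp add: algebra_simps)
    finally have "int k * int k \<le> 2 - (a + d)"
      using tr' by (intro zdvd_imp_le) auto
    moreover have "3 * 3 \<le> int k * int k" using k by (intro mult_mono) auto
    ultimately show False using tr' by linarith
  qed
  with im1 b det have "b = 0" "d = a" "a * a = 1" by auto
  have "a = 1"
  proof (rule ccontr)
    assume "a \<noteq> 1"
    with \<open>a * a = 1\<close> have "a = - 1" using zmult_eq_1_iff by blast
    then have "int k dvd 2" using dv(1) by simp
    then have "int k \<le> 2" by (intro zdvd_imp_le) auto
    with k show False by simp
  qed
  with \<open>c = 0\<close> \<open>b = 0\<close> \<open>d = a\<close> show ?thesis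
    by (simp add: vec_eq_iff forall_2 mat_def abcd)
qed

lemma act_fixed_point:
  assumes "k \<ge> 3" "A \<in> Gamma_level k" "x \<in> HC" "act A mn x = x"
  shows "act A mn y = y"
proof -
  obtain m n where mn: "mn = (m, n)" by fastforce
  have \<tau>: "Im (fst x) > 0" using assms by (simp add: HC_iff)
  have nz: "den A (fst x) \<noteq> 0" using assms den_nonzero Gamma_level_det \<tau> by blast
  have "num A (fst x) / den A (fst x) = fst x"
    using arg_cong[OF assms(4), of fst] by (simp add: mn act_eq)
  then have A1: "A = mat 1"
    using Gamma_level_fixed_point[OF assms(1,2) \<tau>] nz by (simp add: divide_eq_eq)
  have "of_int m + of_int n * fst x = 0"
    using arg_cong[OF assms(4), of snd] by (simp add: mn act_eq A1 den_def mat_def)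
  then have *: "Im (of_int m + of_int n * fst x) = 0" "Re (of_int m + of_int n * fst x) = 0"
    by simp_all
  then have "n = 0" using \<tau> by simp
  with * have "m = 0" by simp
  with \<open>n = 0\<close> A1 mn act_mat1 show ?thesis by simp
qed

text \<open>A bound on a lattice vector \<open>p \<tau> + q\<close> bounds \<open>p\<close> through the imaginary part, and then \<open>q\<close>.\<close>

lemma lattice_coefficients_bounded:
  fixes p q :: int
  assumes "cmod (of_int p * \<tau> + of_int q) \<le> M" "s \<le> Im \<tau>" "s > 0" "cmod \<tau> \<le> R"
  shows "\<bar>p\<bar> \<le> M / s" "\<bar>q\<bar> \<le> M + M / s * R"
proof -
  have "\<bar>p\<bar> * s \<le> \<bar>p\<bar> * Im \<tau>" using assms by (intro mult_left_mono) auto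
  also have "\<dots> = \<bar>Im (of_int p * \<tau> + of_int q)\<bar>" using assms by (simp add: abs_mult)
  also have "\<dots> \<le> M" using assms(1) abs_Im_le_cmod order_trans by blast
  finally show p: "\<bar>p\<bar> \<le> M / s" using assms by (simp add: field_simps)
  have "of_int q = (of_int p * \<tau> + of_int q) - of_int p * \<tau>" by simp
  then have "cmod (of_int q) \<le> cmod (of_int p * \<tau> + of_int q) + cmod (of_int p * \<tau>)"
    by (metis norm_triangle_ineq4)
  also have "cmod (of_int p * \<tau>) \<le> M / s * R"
    unfolding norm_mult norm_of_int using p assms by (intro mult_mono) auto
  finally show "\<bar>q\<bar> \<le> M + M / s * R" using assms(1) by simp
qed

text \<open>Proper discontinuity. If \<open>y\<close> and its image \<open>y'\<close> both lie in the ball, the heights of their first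
  coordinates are comparable, and \<open>Im \<tau>' = Im \<tau> / \<bar>c \<tau> + d\<bar>\<^sup>2\<close> bounds \<open>c \<tau> + d\<close>. Then
  \<open>a \<tau> + b = \<tau>' (c \<tau> + d)\<close> and \<open>m + n \<tau> = z' (c \<tau> + d) - z\<close> are bounded as well, and these three lattice
  vectors leave finitely many choices for the six integers.\<close>

lemma finite_returns:
  assumes "x \<in> HC"
  obtains G where "finite G"
    "\<And>A mn y. det A = 1 \<Longrightarrow> y \<in> ball x (Im (fst x) / 2) \<Longrightarrow>
      act A mn y \<in> ball x (Im (fst x) / 2) \<Longrightarrow> act A mn \<in> G"
proof -
  define s where "s = Im (fst x) / 2"
  define R where "R = norm x + s"
  define M where "M = 2 + 3 * R"
  define N where "N = \<lceil>max (M / s) (M + M / s * R)\<rceil>"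
  define I where "I = {-N..N}"
  have s: "s > 0" using assms by (simp add: s_def HC_iff)
  then have R: "R > 0" by (simp add: R_def add_nonneg_pos)
  \<comment> \<open>\<open>R\<close> bounds the points of the ball; \<open>M\<close> then bounds all three lattice vectors, since each of
    them is at most \<open>2\<close>, \<open>2 R\<close> or \<open>2 R + R\<close>.\<close>
  have near: "s \<le> Im (fst y)" "Im (fst y) < 3 * s" "cmod (fst y) \<le> R" "cmod (snd y) \<le> R"
    if "y \<in> ball x s" for y
  proof -
    have "norm (y - x) < s" using that by (simp add: dist_norm norm_minus_commute)
    moreover have "norm (fst (y - x)) \<le> norm (y - x)" by (metis norm_fst_le prod.collapse)
    moreover have "\<bar>Im (fst (y - x))\<bar> \<le> norm (fst (y - x))" by (rule abs_Im_le_cmod)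
    ultimately show "s \<le> Im (fst y)" "Im (fst y) < 3 * s" by (simp_all add: s_def abs_less_iff)
    have "norm y \<le> R"
      using \<open>norm (y - x) < s\<close> norm_triangle_sub[of y x] by (simp add: R_def)
    then show "cmod (fst y) \<le> R" "cmod (snd y) \<le> R"
      using norm_fst_le[of "fst y" "snd y"] norm_snd_le[of "snd y" "fst y"] by simp_all
  qed
  have in_I: "p \<in> I" "q \<in> I"
    if "cmod (of_int p * fst y + of_int q) \<le> M" "y \<in> ball x s" for p q :: int and y
  proof -
    have "\<bar>real_of_int p\<bar> \<le> N" "\<bar>real_of_int q\<bar> \<le> N"
      using lattice_coefficients_bounded[OF that(1) near(1)[OF that(2)] s near(3)[OF that(2)]]
      unfolding N_def by linarith+
    then show "p \<in> I" "q \<in> I" unfolding I_def by auto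
  qed
  define G where "G = (\<lambda>(a, b, c, d, m, n). act (mat2 a b c d) (m, n)) ` (I \<times> I \<times> I \<times> I \<times> I \<times> I)"
  have "finite G" by (simp add: G_def I_def)
  moreover have "act A mn \<in> G"
    if det: "det A = 1" and y: "y \<in> ball x s" and gy: "act A mn y \<in> ball x s" for A mn y
  proof -
    obtain m n where mn: "mn = (m, n)" by fastforce
    define J where "J = den A (fst y)"
    have J0: "J \<noteq> 0" using near(1)[OF y] s det den_nonzero by (simp add: J_def)
    have J: "cmod J \<le> 2"
    proof -
      have "s * (cmod J)\<^sup>2 \<le> Im (fst y) / (cmod J)\<^sup>2 * (cmod J)\<^sup>2"
        using near(1)[OF gy] by (intro mult_right_mono) (simp_all add: mn act_eq Im_moebius det J_def)
      also have "\<dots> \<le> s * 3" using J0 near(2)[OF y] by simp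
      finally have "(cmod J)\<^sup>2 \<le> 3" using s by simp
      then have "(cmod J)\<^sup>2 \<le> 2\<^sup>2" by simp
      then show ?thesis by (rule power2_le_imp_le) simp
    qed
    have "num A (fst y) = fst (act A mn y) * J"
      using J0 by (simp add: mn act_eq J_def)
    then have "cmod (num A (fst y)) \<le> R * 2"
      using near(3)[OF gy] J R by (simp add: norm_mult) (intro mult_mono, auto)
    moreover have "snd (act A mn y) * J = snd y + of_int m + of_int n * fst y"
      using J0 by (simp add: mn act_eq J_def)
    then have "of_int n * fst y + of_int m = snd (act A mn y) * J - snd y"
      by (simp add: algebra_simps)
    then have "cmod (of_int n * fst y + of_int m) \<le> cmod (snd (act A mn y) * J) + cmod (snd y)"
      by (metis norm_triangle_ineq4)
    moreover have "cmod (snd (act A mn y) * J) \<le> R * 2"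
      using near(4)[OF gy] J R by (simp add: norm_mult) (intro mult_mono, auto)
    ultimately have "cmod (num A (fst y)) \<le> M" "cmod J \<le> M" "cmod (of_int n * fst y + of_int m) \<le> M"
      using J R near(4)[OF y] unfolding M_def by linarith+
    then have "A $ 1 $ 1 \<in> I" "A $ 1 $ 2 \<in> I" "A $ 2 $ 1 \<in> I" "A $ 2 $ 2 \<in> I" "m \<in> I" "n \<in> I"
      using in_I[OF _ y] by (auto simp: num_def den_def J_def)
    then show ?thesis
      unfolding G_def mn
      by (intro image_eqI[of _ _ "(A $ 1 $ 1, A $ 1 $ 2, A $ 2 $ 1, A $ 2 $ 2, m, n)"])
        (simp_all add: mat2_entries)
  qed
  ultimately show ?thesis using that unfolding s_def by blast
qed

text \<open>Each of the finitely many group elements that return points to the ball either moves \<open>x\<close>, and then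
  by continuity moves every sufficiently small ball around \<open>x\<close> off itself, or fixes \<open>x\<close>, and then by
  freeness is the identity map.\<close>

lemma proj_locally_injective:
  assumes k: "k \<ge> 3" and x: "x \<in> HC"
  obtains r where "r > 0" "ball x r \<subseteq> HC" "inj_on (proj k) (ball x r)"
proof -
  obtain G where G: "finite G"
    "\<And>A mn y. det A = 1 \<Longrightarrow> y \<in> ball x (Im (fst x) / 2) \<Longrightarrow>
      act A mn y \<in> ball x (Im (fst x) / 2) \<Longrightarrow> act A mn \<in> G"
    using finite_returns[OF x] by blast
  define H where "H = {g \<in> G. g x \<noteq> x \<and> isCont g x}"
  have sep: "eventually (\<lambda>r. \<forall>y\<in>ball x r. g y \<notin> ball x r) (at_right 0)" if "g \<in> H" for g
  proof -
    define e where "e = dist x (g x) / 2"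
    have "e > 0" using that by (auto simp: e_def H_def)
    moreover have "isCont g x" using that by (simp add: H_def)
    ultimately obtain d where d: "d > 0" "\<And>y. dist y x < d \<Longrightarrow> dist (g y) (g x) < e"
      unfolding continuous_at_eps_delta by blast
    have "g y \<notin> ball x r" if "r < min d e" "y \<in> ball x r" for r y
    proof
      assume "g y \<in> ball x r"
      then have "dist x (g y) < e" using that by simp
      moreover have "dist (g y) (g x) < e" using that d(2)[of y] by (simp add: dist_commute)
      ultimately show False using dist_triangle[of x "g x" "g y"] by (simp add: e_def)
    qed
    then have "\<forall>r>0. r < min d e \<longrightarrow> (\<forall>y\<in>ball x r. g y \<notin> ball x r)" by blast
    then show ?thesis
      using d(1) \<open>e > 0\<close> unfolding eventually_at_right_field by (intro exI[of _ "min d e"]) auto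
  qed
  obtain r0 where r0: "r0 > 0" "ball x r0 \<subseteq> HC"
    using open_HC x open_contains_ball by blast
  define m where "m = min r0 (Im (fst x) / 2)"
  have m: "m > 0" using r0 x by (simp add: m_def HC_iff)
  have "finite H" using G(1) by (simp add: H_def)
  then have "eventually (\<lambda>r. \<forall>g\<in>H. \<forall>y\<in>ball x r. g y \<notin> ball x r) (at_right 0)"
    using sep by (intro eventually_ball_finite) auto
  moreover have "eventually (\<lambda>r. r < m \<and> r > 0) (at_right 0)"
    using m unfolding eventually_at_right_field by blast
  ultimately have "eventually (\<lambda>r. (\<forall>g\<in>H. \<forall>y\<in>ball x r. g y \<notin> ball x r) \<and> r < m \<and> r > 0) (at_right 0)"
    by (rule eventually_conj)
  then obtain r where r: "\<And>g y. g \<in> H \<Longrightarrow> y \<in> ball x r \<Longrightarrow> g y \<notin> ball x r" "r < m" "r > 0"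
    using eventually_happens'[OF trivial_limit_at_right_real] by blast
  have sub: "ball x r \<subseteq> HC" "ball x r \<subseteq> ball x (Im (fst x) / 2)"
    using r0(2) r(2) unfolding m_def by (auto simp: subset_iff)
  moreover have "inj_on (proj k) (ball x r)"
  proof (rule inj_onI)
    fix y z assume yz: "y \<in> ball x r" "z \<in> ball x r" "proj k y = proj k z"
    then obtain A mn where A: "A \<in> Gamma_level k" "z = act A mn y"
      using proj_eq_iff[of y z k] sub(1) by blast
    then have "act A mn \<in> G" using G(2)[of A y mn] Gamma_level_det sub(2) yz by blast
    moreover have "isCont (act A mn) x" using A isCont_act Gamma_level_det x by blast
    moreover have "act A mn \<notin> H" using r(1)[of "act A mn" y] yz A by blast
    ultimately have "act A mn x = x" by (simp add: H_def)
    then show "y = z" using act_fixed_point[OF k A(1) x] A(2) by metis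
  qed
  ultimately show ?thesis using that r(3) by blast
qed


section \<open>Charts, tangent vectors and abelian logarithms\<close>

lemma frechet_derivative_cong_nhds:
  assumes "\<forall>\<^sub>F y in nhds x. f y = g y"
  shows "frechet_derivative f (at x) = frechet_derivative g (at x)"
proof -
  have fg: "f x = g x" "\<forall>\<^sub>F y in at x. f y = g y"
    using assms eventually_nhds_x_imp_x by (auto simp: eventually_nhds_conv_at)
  then have "\<forall>\<^sub>F y in at x. g y = f y" by (simp add: eq_commute)
  with fg have "(f has_derivative D) (at x) \<longleftrightarrow> (g has_derivative D) (at x)" for D
    using has_derivative_transform_eventually[of f D x UNIV g]
      has_derivative_transform_eventually[of g D x UNIV f] by auto
  then show ?thesis by (simp add: frechet_derivative_def)
qed

lemma has_derivative_cong_nhds: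
  assumes "\<forall>\<^sub>F y in nhds x. f y = g y" "(g has_derivative D) (at x)"
  shows "(f has_derivative D) (at x)"
proof -
  have "f x = g x" "\<forall>\<^sub>F y in at x. g y = f y"
    using assms(1) eventually_nhds_x_imp_x[OF assms(1)]
    by (auto simp: eventually_nhds_conv_at eq_commute)
  then show ?thesis using has_derivative_transform_eventually[OF assms(2)] by simp
qed

lemma act_frechet_derivative:
  assumes "A \<in> Gamma_level k" "x \<in> HC"
  shows "(act A mn has_derivative frechet_derivative (act A mn) (at x)) (at x)"
proof -
  obtain L where "(act A mn has_derivative L) (at x)"
    using act_has_derivative[OF Gamma_level_det[OF assms(1)] assms(2)] by blast
  then show ?thesis using frechet_derivative_at by force
qed

lemma atlas_cases:
  assumes "c \<in> M0_atlas k"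
  obtains V where "V \<subseteq> HC" "open V" "inj_on (proj k) V" "c = (proj k ` V, inv_into V (proj k))"
  using assms by (auto simp: M0_atlas_def)

text \<open>The value of the section at \<open>proj k x\<close> is some translate of \<open>x\<close>. The same group element carries
  nearby points into \<open>V\<close>, and injectivity of the projection on \<open>V\<close> leaves no other value for the section
  there.\<close>

lemma section_locally_act:
  assumes V: "V \<subseteq> HC" "open V" "inj_on (proj k) V" and x: "x \<in> HC" "proj k x \<in> proj k ` V"
  shows "\<exists>A\<in>Gamma_level k. \<exists>mn. inv_into V (proj k) (proj k x) = act A mn x \<and>
    (\<forall>\<^sub>F y in nhds x. proj k y \<in> proj k ` V \<and> inv_into V (proj k) (proj k y) = act A mn y)"
proof -
  have *: "inv_into V (proj k) (proj k x) \<in> V" "proj k (inv_into V (proj k) (proj k x)) = proj k x"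
    by (rule inv_into_into[OF x(2)], rule f_inv_into_f[OF x(2)])
  then obtain A mn where A: "A \<in> Gamma_level k" "inv_into V (proj k) (proj k x) = act A mn x"
    using proj_eq_iff[of x "inv_into V (proj k) (proj k x)" k] x(1) V(1) by (metis subsetD)
  have "isCont (act A mn) x" using A isCont_act Gamma_level_det x by blast
  then have "filterlim (act A mn) (nhds (act A mn x)) (nhds x)"
    using tendsto_at_iff_tendsto_nhds isCont_def by blast
  moreover have "\<forall>\<^sub>F z in nhds (act A mn x). z \<in> V"
    using * A V by (intro eventually_nhds_in_open) auto
  ultimately have "\<forall>\<^sub>F y in nhds x. act A mn y \<in> V" by (rule eventually_compose_filterlim[rotated])
  moreover have "\<forall>\<^sub>F y in nhds x. y \<in> HC" using x open_HC by (intro eventually_nhds_in_open)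
  ultimately have "\<forall>\<^sub>F y in nhds x. proj k y \<in> proj k ` V \<and> inv_into V (proj k) (proj k y) = act A mn y"
  proof eventually_elim
    case (elim y)
    have "proj k (act A mn y) = proj k y" using elim A proj_act by blast
    moreover have "inv_into V (proj k) (proj k (act A mn y)) = act A mn y"
      using elim V by (intro inv_into_f_f)
    ultimately show ?case using elim(1) by (metis imageI)
  qed
  with A show ?thesis by blast
qed

lemma chart_at_point:
  assumes "c \<in> charts_at (M0_atlas k) p"
  shows "snd c p \<in> HC" "proj k (snd c p) = p"
    "\<forall>\<^sub>F y in nhds (snd c p). chart_inv c y = proj k y"
proof -
  obtain V where V: "V \<subseteq> HC" "open V" "inj_on (proj k) V" "c = (proj k ` V, inv_into V (proj k))"
    using assms atlas_cases unfolding charts_at_def by blast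
  then have p: "p \<in> proj k ` V" using assms by (simp add: charts_at_def)
  then have "snd c p \<in> V" using V(4) by (simp add: inv_into_into)
  then show "snd c p \<in> HC" using V by blast
  show "proj k (snd c p) = p" using p V(4) by (simp add: f_inv_into_f)
  have "\<forall>\<^sub>F y in nhds (snd c p). y \<in> V"
    using \<open>snd c p \<in> V\<close> V by (intro eventually_nhds_in_open)
  then show "\<forall>\<^sub>F y in nhds (snd c p). chart_inv c y = proj k y"
  proof eventually_elim
    case (elim y)
    have "inj_on (inv_into V (proj k)) (proj k ` V)" by (simp add: inj_on_inv_into)
    then have "inv_into (proj k ` V) (inv_into V (proj k)) (inv_into V (proj k) (proj k y)) = proj k y"
      using elim by (intro inv_into_f_f) auto
    then show ?case using V elim by (simp add: chart_inv_def inv_into_f_f)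
  qed
qed

lemma chart_proj_locally_act:
  assumes "x \<in> HC" "c \<in> charts_at (M0_atlas k) (proj k x)"
  shows "\<exists>A\<in>Gamma_level k. \<exists>mn. snd c (proj k x) = act A mn x \<and>
    (\<forall>\<^sub>F y in nhds x. proj k y \<in> fst c \<and> snd c (proj k y) = act A mn y)"
proof -
  obtain V where V: "V \<subseteq> HC" "open V" "inj_on (proj k) V" "c = (proj k ` V, inv_into V (proj k))"
    using assms atlas_cases unfolding charts_at_def by blast
  then show ?thesis
    using section_locally_act[OF V(1-3) assms(1)] assms(2) by (simp add: charts_at_def)
qed

lemma chart_transition:
  assumes "c \<in> charts_at (M0_atlas k) p" "c' \<in> charts_at (M0_atlas k) p"
  shows "\<exists>A\<in>Gamma_level k. \<exists>mn. snd c' p = act A mn (snd c p) \<and>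
    (\<forall>\<^sub>F y in nhds (snd c p). chart_inv c y \<in> fst c' \<and> snd c' (chart_inv c y) = act A mn y)"
proof -
  note c = chart_at_point[OF assms(1)]
  obtain A mn where A: "A \<in> Gamma_level k" "snd c' p = act A mn (snd c p)"
    "\<forall>\<^sub>F y in nhds (snd c p). proj k y \<in> fst c' \<and> snd c' (proj k y) = act A mn y"
    using chart_proj_locally_act[of "snd c p" c' k] assms(2) c(1,2) by auto
  from A(3) c(3) have "\<forall>\<^sub>F y in nhds (snd c p). chart_inv c y \<in> fst c' \<and> snd c' (chart_inv c y) = act A mn y"
    by eventually_elim simp
  with A show ?thesis by blast
qed

lemma tangent_space_chart:
  assumes "\<xi> \<in> tangent_space A p" "c \<in> charts_at A p" "c' \<in> charts_at A p"
  shows "\<xi> c' = frechet_derivative (snd c' \<circ> chart_inv c) (at (snd c p)) (\<xi> c)"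
  using assms unfolding tangent_space_def by blast

lemma tangent_transition:
  assumes "c \<in> charts_at (M0_atlas k) p" "c' \<in> charts_at (M0_atlas k) p"
  shows "\<exists>A\<in>Gamma_level k. \<exists>mn. snd c' p = act A mn (snd c p) \<and>
    (\<forall>\<xi>\<in>tangent_space (M0_atlas k) p. \<xi> c' = frechet_derivative (act A mn) (at (snd c p)) (\<xi> c)) \<and>
    (\<forall>\<^sub>F y in nhds (snd c p). chart_inv c y \<in> fst c' \<and> snd c' (chart_inv c y) = act A mn y)"
proof -
  obtain A mn where A: "A \<in> Gamma_level k" "snd c' p = act A mn (snd c p)"
    "\<forall>\<^sub>F y in nhds (snd c p). chart_inv c y \<in> fst c' \<and> snd c' (chart_inv c y) = act A mn y"
    using chart_transition[OF assms] by blast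
  have "frechet_derivative (snd c' \<circ> chart_inv c) (at (snd c p)) =
      frechet_derivative (act A mn) (at (snd c p))"
    by (rule frechet_derivative_cong_nhds, rule eventually_mono[OF A(3)]) simp
  then have "\<forall>\<xi>\<in>tangent_space (M0_atlas k) p.
      \<xi> c' = frechet_derivative (act A mn) (at (snd c p)) (\<xi> c)"
    using tangent_space_chart assms by metis
  with A show ?thesis by blast
qed

text \<open>Chain rule, with \<open>snd c \<circ> proj k\<close> and \<open>snd c' \<circ> chart_inv c\<close> replaced by the group elements with which they
  agree locally.\<close>

lemma push_vec_tangent:
  assumes "x \<in> HC"
  shows "push_vec (M0_atlas k) (proj k) x v \<in> tangent_space (M0_atlas k) (proj k x)"
  unfolding tangent_space_def
proof (intro CollectI conjI allI ballI impI)
  fix c assume "c \<notin> charts_at (M0_atlas k) (proj k x)"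
  then show "push_vec (M0_atlas k) (proj k) x v c = 0" by (simp add: push_vec_def)
next
  fix c c' assume c: "c \<in> charts_at (M0_atlas k) (proj k x)"
    and c': "c' \<in> charts_at (M0_atlas k) (proj k x)"
  obtain A mn where A: "A \<in> Gamma_level k" "snd c (proj k x) = act A mn x"
    "\<forall>\<^sub>F y in nhds x. proj k y \<in> fst c \<and> snd c (proj k y) = act A mn y"
    using chart_proj_locally_act[OF assms c] by blast
  obtain B pq where B: "B \<in> Gamma_level k" "snd c' (proj k x) = act B pq (snd c (proj k x))"
    "\<forall>\<^sub>F y in nhds (snd c (proj k x)). chart_inv c y \<in> fst c' \<and> snd c' (chart_inv c y) = act B pq y"
    using chart_transition[OF c c'] by blast
  note cp = chart_at_point[OF c]
  define DA where "DA = frechet_derivative (act A mn) (at x)"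
  define DB where "DB = frechet_derivative (act B pq) (at (snd c (proj k x)))"
  have DA: "(act A mn has_derivative DA) (at x)"
    unfolding DA_def by (rule act_frechet_derivative[OF A(1) assms])
  have DB: "(act B pq has_derivative DB) (at (act A mn x))"
    unfolding DB_def A(2)[symmetric] by (rule act_frechet_derivative[OF B(1) cp(1)])
  have "isCont (act A mn) x" using DA by (rule has_derivative_continuous)
  then have "filterlim (act A mn) (nhds (act A mn x)) (nhds x)"
    using tendsto_at_iff_tendsto_nhds isCont_def by blast
  moreover have "\<forall>\<^sub>F y in nhds (act A mn x). chart_inv c y = proj k y \<and> snd c' (chart_inv c y) = act B pq y"
    using eventually_conj[OF cp(3) B(3)] unfolding A(2) by (rule eventually_mono) blast
  ultimately have "\<forall>\<^sub>F y in nhds x. chart_inv c (act A mn y) = proj k (act A mn y) \<and>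
      snd c' (chart_inv c (act A mn y)) = act B pq (act A mn y)"
    by (rule eventually_compose_filterlim[rotated])
  moreover have "\<forall>\<^sub>F y in nhds x. y \<in> HC" using assms open_HC by (intro eventually_nhds_in_open)
  ultimately have "\<forall>\<^sub>F y in nhds x. (snd c' \<circ> proj k) y = (act B pq \<circ> act A mn) y"
  proof eventually_elim
    case (elim y)
    then show ?case using proj_act[OF elim(2) A(1), of mn] by (metis comp_apply)
  qed
  moreover have "(act B pq \<circ> act A mn has_derivative DB \<circ> DA) (at x)"
    by (rule diff_chain_at[OF DA DB])
  ultimately have "((snd c' \<circ> proj k) has_derivative DB \<circ> DA) (at x)"
    by (rule has_derivative_cong_nhds)
  then have "frechet_derivative (snd c' \<circ> proj k) (at x) = DB \<circ> DA"
    by (rule frechet_derivative_at[symmetric])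
  then have "frechet_derivative (snd c' \<circ> proj k) (at x) v = DB (DA v)" by simp
  moreover have "frechet_derivative (snd c \<circ> proj k) (at x) v = DA v"
    using frechet_derivative_cong_nhds[of "snd c \<circ> proj k" "act A mn" x] A(3)
    unfolding DA_def eventually_conj_iff comp_def by simp
  moreover have "frechet_derivative (snd c' \<circ> chart_inv c) (at (snd c (proj k x))) = DB"
    unfolding DB_def
    by (rule frechet_derivative_cong_nhds, rule eventually_mono[OF B(3)]) simp
  ultimately show "push_vec (M0_atlas k) (proj k) x v c' =
      frechet_derivative (snd c' \<circ> chart_inv c) (at (snd c (proj k x)))
        (push_vec (M0_atlas k) (proj k) x v c)"
    using c c' by (simp add: push_vec_def)
qed

lemma push_vec_chart:
  assumes c: "c \<in> charts_at (M0_atlas k) (proj k x)" and x: "x \<in> HC" "snd c (proj k x) = x"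
    and near_id: "\<forall>\<^sub>F y in nhds x. snd c (proj k y) = y"
  shows "push_vec (M0_atlas k) (proj k) x v c = v"
proof -
  have "frechet_derivative (snd c \<circ> proj k) (at x) = frechet_derivative (\<lambda>y. y) (at x)"
    using near_id by (intro frechet_derivative_cong_nhds) simp
  also have "\<dots> = (\<lambda>v. v)" by (rule frechet_derivative_at[OF has_derivative_ident, symmetric])
  finally show ?thesis using c by (simp add: push_vec_def)
qed

text \<open>The differential of the projection is onto: near \<open>snd c p\<close> the projection is the inverse of the
  chart \<open>c\<close>, so the coordinate vector of \<open>\<xi>\<close> in \<open>c\<close> is a preimage. This makes a descended form unique on
  tangent vectors.\<close>

lemma tangent_is_push_vec:
  assumes c: "c \<in> charts_at (M0_atlas k) p" and \<xi>: "\<xi> \<in> tangent_space (M0_atlas k) p"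
  shows "push_vec (M0_atlas k) (proj k) (snd c p) (\<xi> c) = \<xi>"
proof
  fix c'
  note cp = chart_at_point[OF c]
  show "push_vec (M0_atlas k) (proj k) (snd c p) (\<xi> c) c' = \<xi> c'"
  proof (cases "c' \<in> charts_at (M0_atlas k) p")
    case True
    have "frechet_derivative (snd c' \<circ> proj k) (at (snd c p)) =
        frechet_derivative (snd c' \<circ> chart_inv c) (at (snd c p))"
      by (rule frechet_derivative_cong_nhds, rule eventually_mono[OF cp(3)]) simp
    then show ?thesis
      using True cp(2) tangent_space_chart[OF \<xi> c True] by (simp add: push_vec_def)
  next
    case False
    then have "\<xi> c' = 0" using \<xi> unfolding tangent_space_def by blast
    then show ?thesis using False cp(2) by (simp add: push_vec_def)
  qed
qed

lemma push_vec_chart_inv: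
  assumes "c \<in> charts_at (M0_atlas k) p"
  shows "push_vec (M0_atlas k) (chart_inv c) (snd c p) v = push_vec (M0_atlas k) (proj k) (snd c p) v"
proof -
  note cp = chart_at_point[OF assms]
  have *: "frechet_derivative (snd c' \<circ> chart_inv c) (at (snd c p)) =
      frechet_derivative (snd c' \<circ> proj k) (at (snd c p))"
    for c' :: "(point, complex \<times> complex) chart"
    by (rule frechet_derivative_cong_nhds, rule eventually_mono[OF cp(3)]) simp
  show ?thesis
    unfolding push_vec_def eventually_nhds_x_imp_x[OF cp(3)] * ..
qed

lemma chart_proj_id:
  assumes "c \<in> charts_at (M0_atlas k) p"
  shows "\<forall>\<^sub>F y in nhds (snd c p). snd c (proj k y) = y"
proof -
  obtain V where V: "V \<subseteq> HC" "open V" "inj_on (proj k) V" "c = (proj k ` V, inv_into V (proj k))"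
    using assms atlas_cases unfolding charts_at_def by blast
  then have "snd c p \<in> V" using assms by (auto simp: charts_at_def inv_into_into)
  then have "\<forall>\<^sub>F y in nhds (snd c p). y \<in> V" using V by (intro eventually_nhds_in_open)
  then show ?thesis by eventually_elim (simp add: V inv_into_f_f)
qed

lemma chart_through:
  assumes "k \<ge> 3" "x \<in> HC"
  obtains c where "c \<in> charts_at (M0_atlas k) (proj k x)" "snd c (proj k x) = x"
proof -
  obtain r where r: "r > 0" "ball x r \<subseteq> HC" "inj_on (proj k) (ball x r)"
    using proj_locally_injective[OF assms] by blast
  define c where "c = (proj k ` ball x r, inv_into (ball x r) (proj k))"
  have "c \<in> M0_atlas k" using r unfolding c_def M0_atlas_def by blast
  then have "c \<in> charts_at (M0_atlas k) (proj k x)"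
    using r by (auto simp: charts_at_def c_def)
  moreover have "snd c (proj k x) = x" using r by (simp add: c_def inv_into_f_f)
  ultimately show ?thesis using that by blast
qed

text \<open>A ball is used for its connectedness. Openness of its image and holomorphy of both coordinate
  expressions follow from the local description of sections and transition maps by the action.\<close>

lemma abelian_log_ball:
  assumes "x \<in> HC" "r > 0" "ball x r \<subseteq> HC" "inj_on (proj k) (ball x r)"
  shows "abelian_log k (proj k ` ball x r) (ball x r)"
proof -
  let ?V = "ball x r" and ?U = "proj k ` ball x r"
  let ?c = "(proj k ` ball x r, inv_into (ball x r) (proj k))"
  have cA: "?c \<in> M0_atlas k" using assms unfolding M0_atlas_def by blast
  have UM: "?U \<subseteq> M0 k" using assms proj_in_M0 by blast
  have "open (HC \<inter> proj k -` ?U)"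
  proof (subst open_subopen, intro ballI)
    fix y assume y: "y \<in> HC \<inter> proj k -` ?U"
    then have "\<forall>\<^sub>F z in nhds y. proj k z \<in> ?U"
      using section_locally_act[OF assms(3) open_ball assms(4), of y]
      by (auto elim: eventually_mono)
    moreover have "\<forall>\<^sub>F z in nhds y. z \<in> HC" using y open_HC by (intro eventually_nhds_in_open) auto
    ultimately have "\<forall>\<^sub>F z in nhds y. z \<in> HC \<inter> proj k -` ?U" by eventually_elim auto
    then show "\<exists>T. open T \<and> y \<in> T \<and> T \<subseteq> HC \<inter> proj k -` ?U"
      unfolding eventually_nhds by blast
  qed
  then have "openin (M0_top k) ?U" using UM by (simp add: openin_M0_top)
  moreover have "connectedin (M0_top k) ?U"
  proof (rule connectedin_continuous_map_image)
    have "topspace (M0_top k) \<subseteq> M0 k" unfolding topspace_def openin_M0_top by blast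
    moreover have "HC \<inter> proj k -` M0 k = HC" using proj_in_M0 by blast
    then have "openin (M0_top k) (M0 k)" using open_HC by (simp add: openin_M0_top)
    then have "M0 k \<subseteq> topspace (M0_top k)" by (rule openin_subset)
    ultimately have top: "topspace (M0_top k) = M0 k" by blast
    show "continuous_map (top_of_set HC) (M0_top k) (proj k)"
      unfolding continuous_map
    proof (intro conjI allI impI)
      show "proj k ` topspace (top_of_set HC) \<subseteq> topspace (M0_top k)"
        using proj_in_M0 by (auto simp: top)
      fix W assume "openin (M0_top k) W"
      then have "open (HC \<inter> proj k -` W)" by (simp add: openin_M0_top)
      moreover have "HC \<inter> proj k -` W = {y \<in> topspace (top_of_set HC). proj k y \<in> W}" by auto
      ultimately show "openin (top_of_set HC) {y \<in> topspace (top_of_set HC). proj k y \<in> W}"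
        using openin_open_eq[OF open_HC] by auto
    qed
    show "connectedin (top_of_set HC) ?V"
      using assms convex_connected[OF convex_ball] by (simp add: connectedin_subtopology)
  qed
  moreover have "maps_biholomorphically k ?V ?U"
    unfolding maps_biholomorphically_def
  proof (intro conjI ballI)
    show "bij_betw (proj k) ?V ?U" using assms by (simp add: bij_betw_def)
    fix c assume c: "c \<in> M0_atlas k"
    show "holomorphic2_on (snd c \<circ> proj k) (?V \<inter> proj k -` fst c)"
      unfolding holomorphic2_on_def
    proof
      fix y assume y: "y \<in> ?V \<inter> proj k -` fst c"
      then have yHC: "y \<in> HC" and cy: "c \<in> charts_at (M0_atlas k) (proj k y)"
        using assms c by (auto simp: charts_at_def)
      obtain A mn where A: "A \<in> Gamma_level k"
        "\<forall>\<^sub>F z in nhds y. proj k z \<in> fst c \<and> snd c (proj k z) = act A mn z"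
        using chart_proj_locally_act[OF yHC cy] by blast
      have "\<forall>\<^sub>F z in nhds y. (snd c \<circ> proj k) z = act A mn z"
        using A(2) by (rule eventually_mono) simp
      then show "\<exists>L. (snd c \<circ> proj k has_derivative L) (at y) \<and>
          (\<forall>a v. L (cscale a v) = cscale a (L v))"
        using act_has_derivative[OF Gamma_level_det[OF A(1)] yHC] has_derivative_cong_nhds by blast
    qed
    show "holomorphic2_on (inv_into ?V (proj k) \<circ> chart_inv c) (snd c ` (?U \<inter> fst c))"
      unfolding holomorphic2_on_def
    proof
      fix y assume "y \<in> snd c ` (?U \<inter> fst c)"
      then obtain p where p: "p \<in> ?U" "p \<in> fst c" "y = snd c p" by blast
      then have cp: "c \<in> charts_at (M0_atlas k) p" and c0p: "?c \<in> charts_at (M0_atlas k) p"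
        using c cA by (auto simp: charts_at_def)
      obtain A mn where A: "A \<in> Gamma_level k"
        "\<forall>\<^sub>F z in nhds y. chart_inv c z \<in> fst ?c \<and> snd ?c (chart_inv c z) = act A mn z"
        using chart_transition[OF cp c0p] p(3) by blast
      have "\<forall>\<^sub>F z in nhds y. (inv_into ?V (proj k) \<circ> chart_inv c) z = act A mn z"
        using A(2) by (rule eventually_mono) simp
      then show "\<exists>L. (inv_into ?V (proj k) \<circ> chart_inv c has_derivative L) (at y) \<and>
          (\<forall>a v. L (cscale a v) = cscale a (L v))"
        using act_has_derivative[OF Gamma_level_det[OF A(1)]] chart_at_point(1)[OF cp] p(3)
          has_derivative_cong_nhds by blast
    qed
  qed
  ultimately show ?thesis using assms by (simp add: abelian_log_def)
qed

text \<open>The definite description in \<^const>\<open>mdiff\<close> asks for one value that serves all charts. The chart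
  \<open>c0\<close> provides it, because coordinate expressions and coordinate vectors in another chart are both
  related to those in \<open>c0\<close> by the same group element.\<close>

lemma mdiff_chart:
  assumes c0: "c0 \<in> charts_at (M0_atlas k) p" and \<xi>: "\<xi> \<in> tangent_space (M0_atlas k) p"
    and h: "(h has_derivative D) (at (snd c0 p))" and f: "\<And>q. q \<in> fst c0 \<Longrightarrow> f q = h (snd c0 q)"
  shows "mdiff (M0_atlas k) f p \<xi> = D (\<xi> c0)"
proof -
  have "frechet_derivative (f \<circ> chart_inv c) (at (snd c p)) (\<xi> c) = D (\<xi> c0)"
    if c: "c \<in> charts_at (M0_atlas k) p" for c
  proof -
    obtain A mn where A: "A \<in> Gamma_level k" "snd c0 p = act A mn (snd c p)"
      "\<xi> c0 = frechet_derivative (act A mn) (at (snd c p)) (\<xi> c)"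
      "\<forall>\<^sub>F y in nhds (snd c p). chart_inv c y \<in> fst c0 \<and> snd c0 (chart_inv c y) = act A mn y"
      using tangent_transition[OF c c0] \<xi> by blast
    have "\<forall>\<^sub>F y in nhds (snd c p). (f \<circ> chart_inv c) y = (h \<circ> act A mn) y"
      using A(4) by (rule eventually_mono) (simp add: f)
    moreover have "(h \<circ> act A mn has_derivative D \<circ> frechet_derivative (act A mn) (at (snd c p)))
        (at (snd c p))"
      using h unfolding A(2)
      by (intro diff_chain_at act_frechet_derivative[OF A(1) chart_at_point(1)[OF c]])
    ultimately have "(f \<circ> chart_inv c has_derivative D \<circ> frechet_derivative (act A mn) (at (snd c p)))
        (at (snd c p))"
      by (rule has_derivative_cong_nhds)
    then have "frechet_derivative (f \<circ> chart_inv c) (at (snd c p)) =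
        D \<circ> frechet_derivative (act A mn) (at (snd c p))"
      by (rule frechet_derivative_at[symmetric])
    then show ?thesis using A(3) by simp
  qed
  then show ?thesis
    unfolding mdiff_def using c0 by (intro the_equality) (simp, metis)
qed

section \<open>Betti coordinates and their area form\<close>

definition betti2 :: "complex \<times> complex \<Rightarrow> real"
  where "betti2 x = Im (snd x) / Im (fst x)"

definition betti1 :: "complex \<times> complex \<Rightarrow> real"
  where "betti1 x = Re (snd x) - betti2 x * Re (fst x)"

text \<open>The leaves on which both Betti coordinates are constant have tangent direction \<open>(1, \<beta>\<^sub>2)\<close>. This is
  the projection of a tangent vector along the leaf to the fibre direction; both differentials, and
  also \<open>\<mu>\<close>, depend on \<open>v\<close> only through it.\<close>

definition vert :: "complex \<times> complex \<Rightarrow> complex \<times> complex \<Rightarrow> complex"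
  where "vert x v = snd v - of_real (betti2 x) * fst v"

definition dbetti2 :: "complex \<times> complex \<Rightarrow> complex \<times> complex \<Rightarrow> real"
  where "dbetti2 x v = Im (vert x v) / Im (fst x)"

definition dbetti1 :: "complex \<times> complex \<Rightarrow> complex \<times> complex \<Rightarrow> real"
  where "dbetti1 x v = Re (vert x v) - Re (fst x) * dbetti2 x v"

lemma betti_unique:
  assumes "x \<in> HC"
  shows "snd x = of_real b1 + of_real b2 * fst x \<longleftrightarrow> b1 = betti1 x \<and> b2 = betti2 x"
proof -
  have "snd x = of_real b1 + of_real b2 * fst x \<longleftrightarrow>
      Re (snd x) = b1 + b2 * Re (fst x) \<and> Im (snd x) = b2 * Im (fst x)"
    by (simp add: complex_eq_iff)
  also have "Im (snd x) = b2 * Im (fst x) \<longleftrightarrow> b2 = betti2 x"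
    using assms by (auto simp: betti2_def HC_iff)
  finally show ?thesis by (auto simp: betti1_def)
qed

lemma betti_eq:
  assumes "inv_into V (proj k) p \<in> HC"
  shows "betti k V p = (betti1 (inv_into V (proj k) p), betti2 (inv_into V (proj k) p))"
proof -
  obtain \<tau> z where x: "inv_into V (proj k) p = (\<tau>, z)" by fastforce
  have "(THE (b1, b2). z = complex_of_real b1 + complex_of_real b2 * \<tau>) = (betti1 (\<tau>, z), betti2 (\<tau>, z))"
    using betti_unique[OF assms] unfolding x by (intro the_equality) auto
  then show ?thesis by (simp add: betti_def x)
qed

lemma betti2_has_derivative:
  assumes "x \<in> HC"
  shows "(betti2 has_derivative dbetti2 x) (at x)"
proof -
  have nz: "Im (fst x) \<noteq> 0" using assms by (simp add: HC_iff)
  have "((\<lambda>x. Im (snd x) / Im (fst x)) has_derivative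
      (\<lambda>v. (Im (snd v) * Im (fst x) - Im (snd x) * Im (fst v)) / (Im (fst x) * Im (fst x)))) (at x)"
    by (intro has_derivative_divide' nz derivative_intros)
  moreover have "(\<lambda>v. (Im (snd v) * Im (fst x) - Im (snd x) * Im (fst v)) / (Im (fst x) * Im (fst x))) =
      dbetti2 x"
    using nz by (simp add: fun_eq_iff dbetti2_def vert_def betti2_def field_simps)
  ultimately show ?thesis by (simp add: betti2_def[abs_def])
qed

lemma betti1_has_derivative:
  assumes "x \<in> HC"
  shows "(betti1 has_derivative dbetti1 x) (at x)"
  unfolding betti1_def[abs_def]
  by (rule derivative_eq_intros betti2_has_derivative[OF assms] refl)+
    (simp add: fun_eq_iff dbetti1_def vert_def algebra_simps)

definition betti_area :: "complex \<times> complex \<Rightarrow> complex \<times> complex \<Rightarrow> complex \<times> complex \<Rightarrow> complex"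
  where "betti_area x v w = of_real (dbetti1 x v * dbetti2 x w - dbetti1 x w * dbetti2 x v)"

text \<open>Since \<open>a d - b c = 1\<close>, the vector \<open>u + v \<tau>\<close> equals
  \<open>(a u - b v) (c \<tau> + d) + (d v - c u) (a \<tau> + b)\<close>. Division by \<open>c \<tau> + d\<close> displays the Betti coordinates of
  the image.\<close>

lemma betti_act:
  assumes "det A = 1" "x \<in> HC"
  shows "betti1 (act A (m, n) x) =
      A $ 1 $ 1 * (betti1 x + m) - A $ 1 $ 2 * (betti2 x + n)" (is "_ = ?b1")
    and "betti2 (act A (m, n) x) =
      A $ 2 $ 2 * (betti2 x + n) - A $ 2 $ 1 * (betti1 x + m)" (is "_ = ?b2")
proof -
  define \<tau> where "\<tau> = fst x"
  define a b c d where "a = complex_of_int (A $ 1 $ 1)" and "b = complex_of_int (A $ 1 $ 2)"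
    and "c = complex_of_int (A $ 2 $ 1)" and "d = complex_of_int (A $ 2 $ 2)"
  define u v where "u = complex_of_real (betti1 x + m)" and "v = complex_of_real (betti2 x + n)"
  have nz: "den A \<tau> \<noteq> 0" using assms den_nonzero by (simp add: HC_iff \<tau>_def)
  have det: "a * d - b * c = 1"
    unfolding a_def b_def c_def d_def by (rule of_int_det[OF assms(1)])
  have "snd x = of_real (betti1 x) + of_real (betti2 x) * \<tau>"
    using betti_unique[OF assms(2)] unfolding \<tau>_def by blast
  then have "snd x + of_int m + of_int n * \<tau> = u + v * \<tau>"
    by (simp add: u_def v_def algebra_simps)
  also have "\<dots> = (a * d - b * c) * (u + v * \<tau>)" using det by simp
  also have "\<dots> = (a * u - b * v) * (c * \<tau> + d) + (d * v - c * u) * (a * \<tau> + b)"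
    by (simp add: algebra_simps)
  also have "\<dots> = (a * u - b * v) * den A \<tau> + (d * v - c * u) * num A \<tau>"
    by (simp add: num_def den_def a_def b_def c_def d_def)
  finally have "(snd x + of_int m + of_int n * \<tau>) / den A \<tau> =
      (a * u - b * v) + (d * v - c * u) * (num A \<tau> / den A \<tau>)"
    using nz by (simp add: add_divide_distrib)
  then have "snd (act A (m, n) x) = of_real ?b1 + of_real ?b2 * fst (act A (m, n) x)"
    by (simp add: act_eq \<tau>_def a_def b_def c_def d_def u_def v_def)
  then have "?b1 = betti1 (act A (m, n) x) \<and> ?b2 = betti2 (act A (m, n) x)"
    using betti_unique[OF act_in_HC[OF assms]] by blast
  then show "betti1 (act A (m, n) x) = ?b1" "betti2 (act A (m, n) x) = ?b2" by simp_all
qed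

text \<open>Differentiating \<open>betti_act\<close> removes the translations and leaves the matrix with rows \<open>(a, -b)\<close> and
  \<open>(-c, d)\<close>, of determinant 1.\<close>

lemma betti_area_act:
  assumes A: "A \<in> Gamma_level k" and x: "x \<in> HC"
  shows "betti_area (act A mn x) (frechet_derivative (act A mn) (at x) v)
    (frechet_derivative (act A mn) (at x) w) = betti_area x v w"
proof -
  obtain m n where mn: "mn = (m, n)" by fastforce
  define L where "L = frechet_derivative (act A mn) (at x)"
  define a b c d where "a = real_of_int (A $ 1 $ 1)" and "b = real_of_int (A $ 1 $ 2)"
    and "c = real_of_int (A $ 2 $ 1)" and "d = real_of_int (A $ 2 $ 2)"
  note det = Gamma_level_det[OF A]
  have det': "a * d - b * c = 1"
    unfolding a_def b_def c_def d_def by (rule of_int_det[OF det])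
  have L: "(act A mn has_derivative L) (at x)"
    unfolding L_def by (rule act_frechet_derivative[OF A x])
  note gx = act_in_HC[OF det x, of mn]
  have ev: "\<forall>\<^sub>F y in nhds x. y \<in> HC" using x open_HC by (intro eventually_nhds_in_open)
  have "(betti1 \<circ> act A mn has_derivative dbetti1 (act A mn x) \<circ> L) (at x)"
    by (rule diff_chain_at[OF L betti1_has_derivative[OF gx]])
  moreover have "(betti1 \<circ> act A mn has_derivative (\<lambda>v. a * dbetti1 x v - b * dbetti2 x v)) (at x)"
  proof (rule has_derivative_cong_nhds)
    show "\<forall>\<^sub>F y in nhds x. (betti1 \<circ> act A mn) y = a * (betti1 y + m) - b * (betti2 y + n)"
      using ev by eventually_elim (simp add: mn betti_act[OF det] a_def b_def)
    show "((\<lambda>y. a * (betti1 y + m) - b * (betti2 y + n)) has_derivative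
        (\<lambda>v. a * dbetti1 x v - b * dbetti2 x v)) (at x)"
      by (rule derivative_eq_intros betti1_has_derivative[OF x] betti2_has_derivative[OF x] refl)+ simp
  qed
  ultimately have "dbetti1 (act A mn x) \<circ> L = (\<lambda>v. a * dbetti1 x v - b * dbetti2 x v)"
    by (rule has_derivative_unique)
  from fun_cong[OF this] have 1: "dbetti1 (act A mn x) (L v) = a * dbetti1 x v - b * dbetti2 x v" for v
    by simp
  have "(betti2 \<circ> act A mn has_derivative dbetti2 (act A mn x) \<circ> L) (at x)"
    by (rule diff_chain_at[OF L betti2_has_derivative[OF gx]])
  moreover have "(betti2 \<circ> act A mn has_derivative (\<lambda>v. d * dbetti2 x v - c * dbetti1 x v)) (at x)"
  proof (rule has_derivative_cong_nhds)
    show "\<forall>\<^sub>F y in nhds x. (betti2 \<circ> act A mn) y = d * (betti2 y + n) - c * (betti1 y + m)"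
      using ev by eventually_elim (simp add: mn betti_act[OF det] c_def d_def)
    show "((\<lambda>y. d * (betti2 y + n) - c * (betti1 y + m)) has_derivative
        (\<lambda>v. d * dbetti2 x v - c * dbetti1 x v)) (at x)"
      by (rule derivative_eq_intros betti1_has_derivative[OF x] betti2_has_derivative[OF x] refl)+ simp
  qed
  ultimately have "dbetti2 (act A mn x) \<circ> L = (\<lambda>v. d * dbetti2 x v - c * dbetti1 x v)"
    by (rule has_derivative_unique)
  from fun_cong[OF this] have 2: "dbetti2 (act A mn x) (L v) = d * dbetti2 x v - c * dbetti1 x v" for v
    by simp
  have "dbetti1 (act A mn x) (L v) * dbetti2 (act A mn x) (L w) -
      dbetti1 (act A mn x) (L w) * dbetti2 (act A mn x) (L v) =
      (a * d - b * c) * (dbetti1 x v * dbetti2 x w - dbetti1 x w * dbetti2 x v)"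
    unfolding 1 2 by (simp add: algebra_simps)
  then show ?thesis unfolding betti_area_def L_def[symmetric] det' by simp
qed

text \<open>The open set \<open>V\<close> of an abelian logarithm is itself the image of a chart, in which the locally
  defined Betti coordinates are the restrictions of \<^const>\<open>betti1\<close> and \<^const>\<open>betti2\<close>.\<close>

lemma betti_form_chart:
  assumes log: "abelian_log k U V" and p: "p \<in> U"
    and \<xi>: "\<xi> \<in> tangent_space (M0_atlas k) p" and \<eta>: "\<eta> \<in> tangent_space (M0_atlas k) p"
  obtains c where "c \<in> charts_at (M0_atlas k) p"
    "betti_form k V p \<xi> \<eta> = betti_area (snd c p) (\<xi> c) (\<eta> c)"
proof -
  define c where "c = (proj k ` V, inv_into V (proj k))"
  have V: "V \<subseteq> HC" "open V" "inj_on (proj k) V" "U = proj k ` V"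
    using log by (auto simp: abelian_log_def maps_biholomorphically_def bij_betw_def)
  then have c: "c \<in> charts_at (M0_atlas k) p"
    using p unfolding charts_at_def c_def M0_atlas_def by auto
  note cp = chart_at_point(1)[OF c]
  have b: "betti k V q = (betti1 (snd c q), betti2 (snd c q))" if "q \<in> fst c" for q
  proof -
    have "inv_into V (proj k) q \<in> V" using that by (simp add: c_def inv_into_into)
    then show ?thesis using betti_eq V(1) by (auto simp: c_def)
  qed
  have d1: "((\<lambda>x. complex_of_real (betti1 x)) has_derivative (\<lambda>v. of_real (dbetti1 (snd c p) v)))
      (at (snd c p))"
    by (intro has_derivative_of_real betti1_has_derivative cp)
  have d2: "((\<lambda>x. complex_of_real (betti2 x)) has_derivative (\<lambda>v. of_real (dbetti2 (snd c p) v)))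
      (at (snd c p))"
    by (intro has_derivative_of_real betti2_has_derivative cp)
  have "mdiff (M0_atlas k) (\<lambda>p. complex_of_real (fst (betti k V p))) p \<zeta> = of_real (dbetti1 (snd c p) (\<zeta> c))"
    "mdiff (M0_atlas k) (\<lambda>p. complex_of_real (snd (betti k V p))) p \<zeta> = of_real (dbetti2 (snd c p) (\<zeta> c))"
    if "\<zeta> \<in> tangent_space (M0_atlas k) p" for \<zeta>
    using mdiff_chart[OF c that d1] mdiff_chart[OF c that d2] b by simp_all
  then have "betti_form k V p \<xi> \<eta> = betti_area (snd c p) (\<xi> c) (\<eta> c)"
    using \<xi> \<eta> by (simp add: betti_form_def wedge_def betti_area_def)
  with c show ?thesis using that by blast
qed

section \<open>The form of the potential\<close>

lemma delbar_potential:
  assumes "x \<in> HC"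
  shows "delbar_fun (\<lambda>(\<tau>, z). complex_of_real ((Im z)\<^sup>2 / Im \<tau>)) x w =
    \<i> * of_real (betti2 x) * cnj (snd w) - \<i> / 2 * of_real ((betti2 x)\<^sup>2) * cnj (fst w)"
proof -
  define r where "r = betti2 x"
  have nz: "Im (fst x) \<noteq> 0" using assms by (simp add: HC_iff)
  have d: "((\<lambda>x. (Im (snd x))\<^sup>2) has_derivative (\<lambda>v. 2 * Im (snd x) * Im (snd v))) (at x)"
    by (auto intro!: derivative_eq_intros)
  have "((\<lambda>x. (Im (snd x))\<^sup>2 / Im (fst x)) has_derivative
      (\<lambda>v. (2 * Im (snd x) * Im (snd v) * Im (fst x) - (Im (snd x))\<^sup>2 * Im (fst v)) /
        (Im (fst x) * Im (fst x)))) (at x)"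
    by (rule has_derivative_divide'[OF d has_derivative_Im[OF has_derivative_fst[OF has_derivative_ident]] nz])
  moreover have "(\<lambda>v. (2 * Im (snd x) * Im (snd v) * Im (fst x) - (Im (snd x))\<^sup>2 * Im (fst v)) /
        (Im (fst x) * Im (fst x))) = (\<lambda>v. 2 * r * Im (snd v) - r\<^sup>2 * Im (fst v))"
    using nz by (simp add: fun_eq_iff r_def betti2_def field_simps power2_eq_square)
  ultimately have "((\<lambda>x. complex_of_real ((Im (snd x))\<^sup>2 / Im (fst x))) has_derivative
      (\<lambda>v. of_real (2 * r * Im (snd v) - r\<^sup>2 * Im (fst v)))) (at x)"
    by (intro has_derivative_of_real) simp
  then have "frechet_derivative (\<lambda>(\<tau>, z). complex_of_real ((Im z)\<^sup>2 / Im \<tau>)) (at x) =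
      (\<lambda>v. of_real (2 * r * Im (snd v) - r\<^sup>2 * Im (fst v)))"
    using frechet_derivative_at[symmetric] by (simp add: case_prod_beta')
  then show ?thesis
    by (simp add: delbar_fun_def cscale_def complex_eq_iff field_simps flip: r_def)
qed

text \<open>By the previous lemma the differential of the coefficient for \<open>w\<close> is \<open>\<i> d\<beta>\<^sub>2\<close> times the conjugate of
  \<open>vert x w\<close>, since the terms with \<open>d\<beta>\<^sub>2\<close> from \<open>\<beta>\<^sub>2\<close> and \<open>\<beta>\<^sub>2\<^sup>2\<close> combine. As \<open>d\<beta>\<^sub>2\<close> is the imaginary part of the
  complex linear form \<open>vert x / Im \<tau>\<close>, its (1,0)-part is that form divided by \<open>2 \<i>\<close>.\<close>

lemma del_delbar_potential:
  assumes "x \<in> HC"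
  shows "del_fun (\<lambda>y. delbar_fun (\<lambda>(\<tau>, z). complex_of_real ((Im z)\<^sup>2 / Im \<tau>)) y w) x v =
    vert x v * cnj (vert x w) / of_real (2 * Im (fst x))"
proof -
  define r where "r = betti2 x"
  define t where "t = Im (fst x)"
  have t: "t \<noteq> 0" using assms by (simp add: HC_iff t_def)
  have ev: "\<forall>\<^sub>F y in nhds x. y \<in> HC" using assms open_HC by (intro eventually_nhds_in_open)
  let ?E = "\<lambda>y. \<i> * of_real (betti2 y) * cnj (snd w) - \<i> / 2 * of_real ((betti2 y)\<^sup>2) * cnj (fst w)"
  have d: "((\<lambda>y. complex_of_real (betti2 y)) has_derivative (\<lambda>v. of_real (dbetti2 x v))) (at x)"
    by (intro has_derivative_of_real betti2_has_derivative assms)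
  have "(?E has_derivative (\<lambda>v. \<i> * of_real (dbetti2 x v) * cnj (vert x w))) (at x)"
    unfolding of_real_power
    by (rule derivative_eq_intros d refl)+
      (simp add: fun_eq_iff vert_def field_simps)
  then have "frechet_derivative ?E (at x) = (\<lambda>v. \<i> * of_real (dbetti2 x v) * cnj (vert x w))"
    by (rule frechet_derivative_at[symmetric])
  moreover have "frechet_derivative
      (\<lambda>y. delbar_fun (\<lambda>(\<tau>, z). complex_of_real ((Im z)\<^sup>2 / Im \<tau>)) y w) (at x) = frechet_derivative ?E (at x)"
    by (rule frechet_derivative_cong_nhds, rule eventually_mono[OF ev], rule delbar_potential)
  ultimately have "del_fun (\<lambda>y. delbar_fun (\<lambda>(\<tau>, z). complex_of_real ((Im z)\<^sup>2 / Im \<tau>)) y w) x v =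
      \<i> * (of_real (dbetti2 x v) - \<i> * of_real (dbetti2 x (cscale \<i> v))) / 2 * cnj (vert x w)"
    by (simp add: del_fun_def algebra_simps)
  also have "\<i> * (of_real (dbetti2 x v) - \<i> * of_real (dbetti2 x (cscale \<i> v))) / 2 = vert x v / of_real (2 * t)"
    using t by (simp add: complex_eq_iff dbetti2_def vert_def cscale_def field_simps flip: t_def)
  finally show ?thesis by (simp add: t_def)
qed

lemma mu_eq_betti_area:
  assumes "x \<in> HC"
  shows "mu x v w = betti_area x v w"
proof -
  have t: "Im (fst x) \<noteq> 0" using assms by (simp add: HC_iff)
  have "mu x v w = \<i> * (vert x v * cnj (vert x w) - vert x w * cnj (vert x v)) / of_real (2 * Im (fst x))"
    unfolding mu_def del_form1_def del_delbar_potential[OF assms]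
    by (simp add: diff_divide_distrib right_diff_distrib)
  also have "\<dots> = of_real ((Re (vert x v) * Im (vert x w) - Re (vert x w) * Im (vert x v)) / Im (fst x))"
    using t by (simp add: complex_eq_iff field_simps)
  also have "\<dots> = betti_area x v w"
    using t by (simp add: betti_area_def dbetti1_def dbetti2_def field_simps flip: of_real_diff of_real_mult of_real_divide)
  finally show ?thesis .
qed

section \<open>Smoothness of the coefficients\<close>

text \<open>The algebra generated by the constants, \<open>Im z\<close> and \<open>1 / Im \<tau>\<close> is closed under directional
  derivatives. Membership therefore gives all derivatives at once, without a product rule for
  \<^const>\<open>Cn_on\<close>.\<close>

inductive height_poly :: "(complex \<times> complex \<Rightarrow> complex) \<Rightarrow> bool" where
  const: "height_poly (\<lambda>x. c)"
| height: "height_poly (\<lambda>x. of_real (Im (snd x)))"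
| inv_height: "height_poly (\<lambda>x. of_real (1 / Im (fst x)))"
| add: "height_poly f \<Longrightarrow> height_poly g \<Longrightarrow> height_poly (\<lambda>x. f x + g x)"
| mult: "height_poly f \<Longrightarrow> height_poly g \<Longrightarrow> height_poly (\<lambda>x. f x * g x)"

lemma height_poly_derivative:
  assumes "height_poly f"
  shows "\<exists>D. (\<forall>x\<in>HC. (f has_derivative D x) (at x)) \<and> (\<forall>v. height_poly (\<lambda>x. D x v))"
  using assms
proof induction
  case (const c)
  show ?case by (intro exI[of _ "\<lambda>x v. 0"]) (auto intro: height_poly.const)
next
  case height
  show ?case
    by (intro exI[of _ "\<lambda>x v. of_real (Im (snd v))"])
      (auto intro: height_poly.const intro!: derivative_intros)
next
  case inv_height
  let ?D = "\<lambda>x v. of_real (- Im (fst v)) * (of_real (1 / Im (fst x)) * complex_of_real (1 / Im (fst x)))"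
  have "((\<lambda>x. complex_of_real (1 / Im (fst x))) has_derivative ?D x) (at x)" if "x \<in> HC" for x
  proof -
    have nz: "Im (fst x) \<noteq> 0" using that by (simp add: HC_iff)
    have "((\<lambda>x. 1 / Im (fst x)) has_derivative
        (\<lambda>v. (0 * Im (fst x) - 1 * Im (fst v)) / (Im (fst x) * Im (fst x)))) (at x)"
      by (intro has_derivative_divide' nz derivative_intros)
    then have "((\<lambda>x. complex_of_real (1 / Im (fst x))) has_derivative
        (\<lambda>v. of_real ((0 * Im (fst x) - 1 * Im (fst v)) / (Im (fst x) * Im (fst x))))) (at x)"
      by (rule has_derivative_of_real)
    then show ?thesis by (simp flip: of_real_mult of_real_minus of_real_divide)
  qed
  moreover have "height_poly (\<lambda>x. ?D x v)" for v
    by (intro height_poly.mult height_poly.const height_poly.inv_height)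
  ultimately show ?case by (intro exI[of _ ?D]) blast
next
  case (add f g)
  then obtain D E where "\<forall>x\<in>HC. (f has_derivative D x) (at x)" "\<forall>v. height_poly (\<lambda>x. D x v)"
    "\<forall>x\<in>HC. (g has_derivative E x) (at x)" "\<forall>v. height_poly (\<lambda>x. E x v)" by blast
  then show ?case
    by (intro exI[of _ "\<lambda>x v. D x v + E x v"]) (auto intro: height_poly.add has_derivative_add)
next
  case (mult f g)
  then obtain D E where "\<forall>x\<in>HC. (f has_derivative D x) (at x)" "\<forall>v. height_poly (\<lambda>x. D x v)"
    "\<forall>x\<in>HC. (g has_derivative E x) (at x)" "\<forall>v. height_poly (\<lambda>x. E x v)" by blast
  note DE = this
  have "height_poly (\<lambda>x. f x * E x v + D x v * g x)" for v
    using DE mult.hyps by (intro height_poly.add height_poly.mult) blast+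
  moreover have "((\<lambda>x. f x * g x) has_derivative (\<lambda>v. f x * E x v + D x v * g x)) (at x)"
    if "x \<in> HC" for x
    using DE that by (intro has_derivative_mult) blast+
  ultimately show ?case by (intro exI[of _ "\<lambda>x v. f x * E x v + D x v * g x"]) blast
qed

lemma height_poly_smooth:
  assumes "open S" "S \<subseteq> HC" "height_poly f" "\<And>x. x \<in> S \<Longrightarrow> h x = f x"
  shows "smooth_on h S"
proof -
  have "Cn_on n h S" for n
    using assms(3,4)
  proof (induction n arbitrary: f h)
    case 0
    obtain D where "\<forall>x\<in>HC. (f has_derivative D x) (at x)"
      using height_poly_derivative[OF 0(1)] by blast
    then have "continuous_on S f"
      using assms(2) by (meson continuous_at_imp_continuous_on has_derivative_continuous subsetD)
    then show ?case using 0(2) by (simp cong: continuous_on_cong)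
  next
    case (Suc n)
    obtain D where D: "\<forall>x\<in>HC. (f has_derivative D x) (at x)" "\<forall>v. height_poly (\<lambda>x. D x v)"
      using height_poly_derivative[OF Suc.prems(1)] by blast
    have h: "(h has_derivative D x) (at x)" if "x \<in> S" for x
    proof (rule has_derivative_cong_nhds)
      have "\<forall>\<^sub>F y in nhds x. y \<in> S" using that assms(1) by (intro eventually_nhds_in_open)
      then show "\<forall>\<^sub>F y in nhds x. h y = f y" by eventually_elim (rule Suc.prems(2))
      show "(f has_derivative D x) (at x)" using D that assms(2) by blast
    qed
    have "Cn_on n (\<lambda>x. frechet_derivative h (at x) v) S" for v
    proof (rule Suc.IH)
      show "height_poly (\<lambda>x. D x v)" using D by blast
      show "frechet_derivative h (at x) v = D x v" if "x \<in> S" for x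
        using frechet_derivative_at[OF h[OF that]] by simp
    qed
    moreover have "\<forall>x\<in>S. h differentiable at x"
      using h unfolding differentiable_def by blast
    ultimately show ?case by simp
  qed
  then show ?thesis by (simp add: smooth_on_def)
qed

lemma mu_smooth:
  assumes "open S" "S \<subseteq> HC" "\<And>x. x \<in> S \<Longrightarrow> h x = mu x v w"
  shows "smooth_on h S"
proof -
  define Y I where "Y x = complex_of_real (Im (snd x))" and "I x = complex_of_real (1 / Im (fst x))"
    for x :: "complex \<times> complex"
  define R J where "R u x = of_real (Re (snd u)) + of_real (- Re (fst u)) * (Y x * I x)"
    and "J u x = of_real (Im (snd u)) + of_real (- Im (fst u)) * (Y x * I x)"
    for u x :: "complex \<times> complex"
  have [intro]: "height_poly I" "height_poly Y"
    unfolding I_def Y_def by (rule height_poly.intros)+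
  have [intro]: "height_poly (R u)" "height_poly (J u)" for u
    unfolding R_def J_def by (intro height_poly.intros \<open>height_poly I\<close> \<open>height_poly Y\<close>)+
  show ?thesis
  proof (rule height_poly_smooth[OF assms(1,2)])
    show "height_poly (\<lambda>x. I x * (R v x * J w x + (- 1) * (R w x * J v x)))"
      by (intro height_poly.add height_poly.mult height_poly.const) auto
    fix x assume x: "x \<in> S"
    then have t: "Im (fst x) \<noteq> 0" using assms(2) by (force simp: HC_iff)
    have vert: "of_real (Re (vert x u)) = R u x" "of_real (Im (vert x u)) = J u x" for u
      by (simp_all add: R_def J_def vert_def betti2_def Y_def I_def)
    have "h x = of_real (dbetti1 x v * dbetti2 x w - dbetti1 x w * dbetti2 x v)"
      using assms(3)[OF x] mu_eq_betti_area[of x v w] x assms(2) unfolding betti_area_def by auto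
    also have "dbetti1 x v * dbetti2 x w - dbetti1 x w * dbetti2 x v =
        1 / Im (fst x) * (Re (vert x v) * Im (vert x w) + (- 1) * (Re (vert x w) * Im (vert x v)))"
      using t by (simp add: dbetti1_def dbetti2_def field_simps)
    also have "of_real \<dots> = I x * (R v x * J w x + (- 1) * (R w x * J v x))"
      by (simp add: I_def flip: vert)
    finally show "h x = I x * (R v x * J w x + (- 1) * (R w x * J v x))" .
  qed
qed

section \<open>Descent to the quotient\<close>

lemma mu_tangent_transition:
  assumes "c \<in> charts_at (M0_atlas k) p" "c' \<in> charts_at (M0_atlas k) p"
    "\<xi> \<in> tangent_space (M0_atlas k) p" "\<eta> \<in> tangent_space (M0_atlas k) p"
  shows "mu (snd c' p) (\<xi> c') (\<eta> c') = mu (snd c p) (\<xi> c) (\<eta> c)"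
proof -
  obtain A mn where A: "A \<in> Gamma_level k" "snd c' p = act A mn (snd c p)"
    "\<xi> c' = frechet_derivative (act A mn) (at (snd c p)) (\<xi> c)"
    "\<eta> c' = frechet_derivative (act A mn) (at (snd c p)) (\<eta> c)"
    using tangent_transition[OF assms(1,2)] assms(3,4) by blast
  have "mu (snd c p) (\<xi> c) (\<eta> c) = betti_area (snd c p) (\<xi> c) (\<eta> c)"
    "mu (snd c' p) (\<xi> c') (\<eta> c') = betti_area (snd c' p) (\<xi> c') (\<eta> c')"
    using chart_at_point(1) assms(1,2) mu_eq_betti_area by blast+
  then show ?thesis
    using betti_area_act[OF A(1) chart_at_point(1)[OF assms(1)]] by (simp add: A)
qed

text \<open>The value at \<open>p\<close> is read off in any one chart; invariance makes the choice immaterial. In the chart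
  that is used, the coefficients are those of \<open>\<mu>\<close> itself, so smoothness is that of \<open>\<mu>\<close> on \<open>HC\<close>.\<close>

lemma mu_descends:
  assumes "k \<ge> 3"
  shows "\<exists>\<nu>. descends_to k mu \<nu>"
proof
  let ?A = "M0_atlas k"
  define C where "C p = (SOME c. c \<in> charts_at ?A p)" for p
  define \<nu> where "\<nu> p \<xi> \<eta> = mu (snd (C p) p) (\<xi> (C p)) (\<eta> (C p))"
    for p and \<xi> \<eta> :: "(point, complex \<times> complex) chart \<Rightarrow> complex \<times> complex"
  have C: "C p \<in> charts_at ?A p" if "c \<in> charts_at ?A p" for c p
    using that unfolding C_def by (rule someI)
  have \<nu>: "\<nu> p \<xi> \<eta> = mu (snd c p) (\<xi> c) (\<eta> c)"
    if "c \<in> charts_at ?A p" "\<xi> \<in> tangent_space ?A p" "\<eta> \<in> tangent_space ?A p" for c p \<xi> \<eta>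
    unfolding \<nu>_def by (rule mu_tangent_transition[OF that(1) C[OF that(1)] that(2,3)])
  have push: "\<nu> (proj k x) (push_vec ?A (proj k) x v) (push_vec ?A (proj k) x w) = mu x v w"
    if c: "c \<in> charts_at ?A (proj k x)" "snd c (proj k x) = x" for c x v w
  proof -
    have x: "x \<in> HC" using chart_at_point(1)[OF c(1)] c(2) by simp
    have "push_vec ?A (proj k) x u c = u" for u
      using push_vec_chart[OF c(1) x c(2)] chart_proj_id[OF c(1)] c(2) by simp
    then show ?thesis using \<nu>[OF c(1) push_vec_tangent[OF x] push_vec_tangent[OF x]] c(2) by simp
  qed
  have "two_form_on ?A (M0 k) \<nu>"
    unfolding two_form_on_def
  proof (intro conjI ballI allI)
    fix p \<xi> \<eta> assume "p \<in> M0 k"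
    then obtain x where "x \<in> HC" "p = proj k x" by (auto simp: M0_def proj_def quotient_def)
    then obtain c where "c \<in> charts_at ?A p" using chart_through[OF assms] by blast
    then have HC: "snd (C p) p \<in> HC" using C chart_at_point(1) by blast
    have \<nu>': "\<nu> p \<xi> \<eta> = betti_area (snd (C p) p) (\<xi> (C p)) (\<eta> (C p))" for \<xi> \<eta>
      by (simp add: \<nu>_def mu_eq_betti_area[OF HC])
    have lin1: "dbetti1 y (a + b) = dbetti1 y a + dbetti1 y b" "dbetti1 y (r *\<^sub>R a) = r * dbetti1 y a"
      and lin2: "dbetti2 y (a + b) = dbetti2 y a + dbetti2 y b" "dbetti2 y (r *\<^sub>R a) = r * dbetti2 y a"
      for y a b r
      by (simp_all add: dbetti1_def dbetti2_def vert_def add_divide_distrib diff_divide_distrib algebra_simps)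
    show "\<nu> p \<eta> \<xi> = - \<nu> p \<xi> \<eta>" by (simp add: \<nu>' betti_area_def)
    show "\<nu> p (\<lambda>c. r *\<^sub>R \<xi> c) \<eta> = complex_of_real r * \<nu> p \<xi> \<eta>" for r
      by (simp add: \<nu>' betti_area_def lin1 lin2 algebra_simps)
    show "\<nu> p (\<lambda>c. \<xi> c + \<zeta> c) \<eta> = \<nu> p \<xi> \<eta> + \<nu> p \<zeta> \<eta>" for \<zeta>
      by (simp add: \<nu>' betti_area_def lin1 lin2 algebra_simps)
  next
    fix c v w assume c: "c \<in> ?A"
    then obtain V where V: "V \<subseteq> HC" "open V" "inj_on (proj k) V" "c = (proj k ` V, inv_into V (proj k))"
      by (rule atlas_cases)
    then have img: "snd c ` fst c = V" by (force simp: inv_into_f_f)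
    show "smooth_on (\<lambda>x. \<nu> (chart_inv c x) (push_vec ?A (chart_inv c) x v) (push_vec ?A (chart_inv c) x w))
        (snd c ` fst c)"
      unfolding img
    proof (rule mu_smooth[OF V(2,1)])
      fix x assume x: "x \<in> V"
      then have cx: "c \<in> charts_at ?A (proj k x)" "snd c (proj k x) = x"
        using V c by (auto simp: charts_at_def inv_into_f_f)
      have "chart_inv c x = proj k x"
        using eventually_nhds_x_imp_x[OF chart_at_point(3)[OF cx(1)]] cx(2) by simp
      then show "\<nu> (chart_inv c x) (push_vec ?A (chart_inv c) x v) (push_vec ?A (chart_inv c) x w) = mu x v w"
        using push_vec_chart_inv[OF cx(1)] push[OF cx] cx(2) by simp
    qed
  qed
  moreover have "\<nu> (proj k x) (push_vec ?A (proj k) x v) (push_vec ?A (proj k) x w) = mu x v w"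
    if "x \<in> HC" for x v w
    using chart_through[OF assms that] push by metis
  ultimately show "descends_to k mu \<nu>" by (simp add: descends_to_def)
qed

lemma mu_M0_chart:
  assumes "k \<ge> 3" "c \<in> charts_at (M0_atlas k) p"
    "\<xi> \<in> tangent_space (M0_atlas k) p" "\<eta> \<in> tangent_space (M0_atlas k) p"
  shows "mu_M0 k p \<xi> \<eta> = betti_area (snd c p) (\<xi> c) (\<eta> c)"
proof -
  have "descends_to k mu (mu_M0 k)"
    unfolding mu_M0_def using mu_descends[OF assms(1)] by (rule someI_ex)
  then have "mu_M0 k (proj k (snd c p)) (push_vec (M0_atlas k) (proj k) (snd c p) (\<xi> c))
      (push_vec (M0_atlas k) (proj k) (snd c p) (\<eta> c)) = mu (snd c p) (\<xi> c) (\<eta> c)"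
    using chart_at_point(1)[OF assms(2)] unfolding descends_to_def by blast
  then show ?thesis
    using tangent_is_push_vec[OF assms(2)] assms(3,4) chart_at_point(1,2)[OF assms(2)]
    by (simp add: mu_eq_betti_area)
qed

theorem proposition2p3:
  fixes k :: nat
  assumes "k \<ge> 3"
  shows
    "(\<forall>U V U' V'. abelian_log k U V \<longrightarrow> abelian_log k U' V' \<longrightarrow>
        form_eq_on (M0_atlas k) (U \<inter> U') (betti_form k V) (betti_form k V')) \<and>
     (\<forall>p\<in>M0 k. \<exists>U V. abelian_log k U V \<and> p \<in> U) \<and>
     (\<exists>\<omega>. two_form_on (M0_atlas k) (M0 k) \<omega> \<and>
        (\<forall>U V. abelian_log k U V \<longrightarrow> form_eq_on (M0_atlas k) U \<omega> (betti_form k V)) \<and>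
        form_eq_on (M0_atlas k) (M0 k) (mu_M0 k) \<omega>)"
proof -
  have mu_betti: "form_eq_on (M0_atlas k) U (mu_M0 k) (betti_form k V)" if log: "abelian_log k U V" for U V
    unfolding form_eq_on_def
  proof (intro ballI)
    fix p \<xi> \<eta> assume *: "p \<in> U" "\<xi> \<in> tangent_space (M0_atlas k) p" "\<eta> \<in> tangent_space (M0_atlas k) p"
    obtain c where "c \<in> charts_at (M0_atlas k) p"
      "betti_form k V p \<xi> \<eta> = betti_area (snd c p) (\<xi> c) (\<eta> c)"
      by (rule betti_form_chart[OF log *])
    then show "mu_M0 k p \<xi> \<eta> = betti_form k V p \<xi> \<eta>"
      using mu_M0_chart[OF assms] * by simp
  qed
  have "form_eq_on (M0_atlas k) (U \<inter> U') (betti_form k V) (betti_form k V')"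
    if "abelian_log k U V" "abelian_log k U' V'" for U V U' V'
    using mu_betti[OF that(1)] mu_betti[OF that(2)] unfolding form_eq_on_def by (metis Int_iff)
  moreover have "\<exists>U V. abelian_log k U V \<and> p \<in> U" if p: "p \<in> M0 k" for p
  proof -
    obtain x where x: "x \<in> HC" "p = proj k x" using p by (auto simp: M0_def proj_def quotient_def)
    then obtain r where "r > 0" "ball x r \<subseteq> HC" "inj_on (proj k) (ball x r)"
      using proj_locally_injective[OF assms] by blast
    then have "abelian_log k (proj k ` ball x r) (ball x r)" "p \<in> proj k ` ball x r"
      using abelian_log_ball x by auto
    then show ?thesis by blast
  qed
  moreover have "two_form_on (M0_atlas k) (M0 k) (mu_M0 k)"
    using someI_ex[OF mu_descends[OF assms]] by (simp add: mu_M0_def descends_to_def)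
  moreover have "form_eq_on (M0_atlas k) (M0 k) (mu_M0 k) (mu_M0 k)" by (simp add: form_eq_on_def)
  ultimately show ?thesis using mu_betti by blast
qed

end
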